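(* For every uncountable cardinal $\delta$, the following are equivalent: (1) $\delta$ is either subtle or a limit of subtle cardinals. (2) For every set $\mathcal{C}$ of structures of the same type with $\mathcal{C}\in V_{\delta+1}\setminus V_\delta$, there exists a cardinal $\kappa<\delta$ such that $\mathrm{WSR}_{\mathcal{C}}(\kappa)$ holds.
   Context: Work in ZFC. "Structure" means a structure for a countable first-order language; its cardinality is that of its domain. For a set $A$ of ordinals, an $A$-list is a sequence $\langle E_\alpha:\alpha\in A\rangle$ with $E_\alpha\subseteq\alpha$ for all $\alpha\in A$. An infinite cardinal $\delta$ is subtle if for every $\delta$-list $\langle E_\gamma:\gamma<\delta\rangle$ and every closed unbounded $C\subseteq\delta$ there exist $\beta<\gamma$ in $C$ with $E_\beta=E_\gamma\cap\beta$. For a class $\mathcal{C}$ of structures of the same type and an infinite cardinal $\kappa$, $\mathrm{WSR}_{\mathcal{C}}(\kappa)$ holds iff $\mathcal{C}$ contains a structure of cardinality less than $\kappa$ and for every $B\in\mathcal{C}$ of cardinality $\kappa$ there is $A\in\mathcal{C}$ of cardinality less than $\kappa$ and an elementary embedding of $A$ into $B$. *)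

theory Defs
  imports "HOL-Library.Equipollence" "HOL-Library.Countable_Set"
begin

section \<open>Universes of sets\<close>

text \<open>A type in one of the classes below is a universe of sets: its members are the sets, the
  members of \<open>x\<close> form the HOL set \<open>elts x\<close>, and ``class'' means HOL set. Separation and replacement
  hold for arbitrary HOL predicates and functions. Choice is not listed, since choice in HOL
  together with separation yields it.\<close>

class membership =
  fixes elts :: "'a \<Rightarrow> 'a set"
begin

definition Ord :: "'a \<Rightarrow> bool" where
  "Ord \<alpha> \<longleftrightarrow> (\<forall>x\<in>elts \<alpha>. elts x \<subseteq> elts \<alpha> \<and> (\<forall>y\<in>elts x. elts y \<subseteq> elts x))"

text \<open>\<open>x \<in> V \<alpha>\<close> iff \<open>x \<subseteq> V \<beta>\<close> for some \<open>\<beta> \<in> \<alpha>\<close>, that is, \<open>V \<alpha> = (\<Union>\<beta>\<in>\<alpha>. Pow (V \<beta>))\<close>.\<close>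

inductive in_V :: "'a \<Rightarrow> 'a \<Rightarrow> bool" where
  "\<beta> \<in> elts \<alpha> \<Longrightarrow> (\<And>y. y \<in> elts x \<Longrightarrow> in_V \<beta> y) \<Longrightarrow> in_V \<alpha> x"

definition V :: "'a \<Rightarrow> 'a set" where
  "V \<alpha> = {x. in_V \<alpha> x}"

end

class zermelo = membership +
  assumes extensionality: "elts x = elts y \<Longrightarrow> x = y"
    and foundation: "wf {(x, y). x \<in> elts y}"
    and separation: "\<exists>y. elts y = {z \<in> elts x. P z}"
    and pairing: "\<exists>z. elts z = {x, y}"
    and union: "\<exists>z. elts z = (\<Union>y\<in>elts x. elts y)"
    and powerset: "\<exists>z. elts z = {y. elts y \<subseteq> elts x}"
    and infinity: "\<exists>w. (\<exists>z\<in>elts w. elts z = {}) \<and>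
                       (\<forall>x\<in>elts w. \<exists>y\<in>elts w. elts y = insert x (elts x))"

class zfc = zermelo +
  assumes replacement: "\<exists>z. elts z = f ` elts x"

text \<open>Replacement for all HOL functions makes a universe of class \<open>zfc\<close> look like \<open>V \<kappa>\<close> for an
  inaccessible \<open>\<kappa>\<close>, so that only ordinals below an inaccessible cardinal would be covered. The
  following more general class replaces that axiom by its consequence that every set lies in some
  \<open>V \<alpha>\<close> and every \<open>V \<alpha>\<close> is a set. Its universes are, up to isomorphism, the \<open>V \<lambda>\<close> for limit
  ordinals \<open>\<lambda> > \<omega>\<close>. For every infinite ordinal \<open>\<delta>\<close> the universe \<open>V (\<delta> + \<omega>)\<close> is among them and
  suffices to state properties of \<open>\<delta>\<close> that only concern subsets of \<open>V \<delta>\<close>, functions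
  between its members, and the like.\<close>

class cumulative = zermelo +
  assumes V_is_set: "Ord \<alpha> \<Longrightarrow> \<exists>v. elts v = V \<alpha>"
    and V_covers: "\<exists>\<alpha>. Ord \<alpha> \<and> x \<in> V \<alpha>"

subclass (in zfc) cumulative
proof
  have mem_V: "x \<in> V \<alpha> \<longleftrightarrow> (\<exists>\<beta>\<in>elts \<alpha>. elts x \<subseteq> V \<beta>)" for x \<alpha>
    unfolding V_def by (subst mem_Collect_eq, subst in_V.simps) blast
  show "\<exists>v. elts v = V \<alpha>" for \<alpha>
    using foundation
  proof (induction \<alpha> rule: wf_induct_rule)
    case (less \<alpha>)
    then have "\<forall>\<beta>\<in>elts \<alpha>. \<exists>v. elts v = V \<beta>" by blast
    then obtain v where v: "\<And>\<beta>. \<beta> \<in> elts \<alpha> \<Longrightarrow> elts (v \<beta>) = V \<beta>" by metis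
    obtain p where p: "\<And>x. elts (p x) = {y. elts y \<subseteq> elts x}" using powerset by metis
    obtain r where r: "elts r = (\<lambda>\<beta>. p (v \<beta>)) ` elts \<alpha>" using replacement by metis
    obtain u where u: "elts u = (\<Union>y\<in>elts r. elts y)" using union by metis
    have "x \<in> elts u \<longleftrightarrow> (\<exists>\<beta>\<in>elts \<alpha>. elts x \<subseteq> V \<beta>)" for x
      unfolding u r by (simp add: p v)
    then have "elts u = V \<alpha>" by (auto simp only: set_eq_iff mem_V)
    then show ?case ..
  qed
  show "\<exists>\<alpha>. Ord \<alpha> \<and> x \<in> V \<alpha>" for x
    using foundation
  proof (induction x rule: wf_induct_rule)
    case (less x)
    then have "\<forall>y\<in>elts x. \<exists>\<alpha>. Ord \<alpha> \<and> y \<in> V \<alpha>" by blast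
    then obtain a where a: "\<And>y. y \<in> elts x \<Longrightarrow> Ord (a y) \<and> y \<in> V (a y)" by metis
    obtain r where r: "elts r = a ` elts x" using replacement by metis
    obtain \<beta> where \<beta>: "elts \<beta> = (\<Union>y\<in>elts r. elts y)" using union by metis
    have Ord\<beta>: "Ord \<beta>" using a unfolding Ord_def by (fastforce simp: \<beta> r)
    obtain s where s: "elts s = {\<beta>}" using pairing[of \<beta> \<beta>] by auto
    obtain t where t: "elts t = {\<beta>, s}" using pairing[of \<beta> s] by auto
    obtain \<alpha> where \<alpha>: "elts \<alpha> = insert \<beta> (elts \<beta>)" using union[of t] by (auto simp: t s)
    have "Ord \<alpha>" using Ord\<beta> unfolding Ord_def by (auto simp: \<alpha>)
    moreover have "y \<in> V \<beta>" if "y \<in> elts x" for y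
      using a[OF that] that unfolding mem_V by (auto simp: \<beta> r)
    then have "x \<in> V \<alpha>" by (auto simp: mem_V \<alpha>)
    ultimately show ?case by blast
  qed
qed

definition set_of :: "'a::zermelo set \<Rightarrow> 'a" where
  "set_of X = (THE x. elts x = X)"

definition succ :: "'a::zermelo \<Rightarrow> 'a" where
  "succ x = set_of (insert x (elts x))"

definition opair :: "'a::zermelo \<Rightarrow> 'a \<Rightarrow> 'a" where
  "opair x y = set_of {set_of {x}, set_of {x, y}}"

text \<open>Tuples are nested pairs ending in the empty set, so that a tuple of length 1 or 0 is
  covered too.\<close>

fun tuple :: "'a::zermelo list \<Rightarrow> 'a" where
  "tuple [] = set_of {}"
| "tuple (x # xs) = opair x (tuple xs)"

definition tuples :: "'a::zermelo set \<Rightarrow> nat \<Rightarrow> 'a set" where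
  "tuples D n = {tuple xs |xs. length xs = n \<and> set xs \<subseteq> D}"

definition function_on :: "'a::zermelo \<Rightarrow> 'a set \<Rightarrow> bool" where
  "function_on f X \<longleftrightarrow>
     (\<forall>p\<in>elts f. \<exists>x\<in>X. \<exists>y. p = opair x y) \<and> (\<forall>x\<in>X. \<exists>!y. opair x y \<in> elts f)"

definition app :: "'a::zermelo \<Rightarrow> 'a \<Rightarrow> 'a" where
  "app f x = (THE y. opair x y \<in> elts f)"

section \<open>Cardinals and subtlety\<close>

definition Card :: "'a::zermelo \<Rightarrow> bool" where
  "Card \<kappa> \<longleftrightarrow> Ord \<kappa> \<and> (\<forall>\<alpha>\<in>elts \<kappa>. \<not> elts \<alpha> \<approx> elts \<kappa>)"

definition closed_unbounded :: "'a::zermelo \<Rightarrow> 'a \<Rightarrow> bool" where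
  "closed_unbounded C \<delta> \<longleftrightarrow> elts C \<subseteq> elts \<delta> \<and>
     (\<forall>\<alpha>\<in>elts \<delta>. \<exists>\<beta>\<in>elts C. \<alpha> \<in> elts \<beta>) \<and>
     (\<forall>\<alpha>\<in>elts \<delta>. elts \<alpha> \<noteq> {} \<and> (\<forall>\<beta>\<in>elts \<alpha>. \<exists>\<gamma>\<in>elts C \<inter> elts \<alpha>. \<beta> \<in> elts \<gamma>) \<longrightarrow> \<alpha> \<in> elts C)"

text \<open>The sequence \<open>E\<close> is given by a HOL function whose values outside \<open>A\<close> are irrelevant.\<close>

definition ordinal_list :: "'a::zermelo \<Rightarrow> ('a \<Rightarrow> 'a) \<Rightarrow> bool" where
  "ordinal_list A E \<longleftrightarrow> (\<forall>\<alpha>\<in>elts A. elts (E \<alpha>) \<subseteq> elts \<alpha>)"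

definition subtle :: "'a::zermelo \<Rightarrow> bool" where
  "subtle \<delta> \<longleftrightarrow> Card \<delta> \<and> infinite (elts \<delta>) \<and>
     (\<forall>E C. ordinal_list \<delta> E \<and> closed_unbounded C \<delta> \<longrightarrow>
        (\<exists>\<beta>\<in>elts C. \<exists>\<gamma>\<in>elts C. \<beta> \<in> elts \<gamma> \<and> elts (E \<beta>) = elts (E \<gamma>) \<inter> elts \<beta>))"

definition limit_of_subtle :: "'a::zermelo \<Rightarrow> bool" where
  "limit_of_subtle \<delta> \<longleftrightarrow> (\<forall>\<alpha>\<in>elts \<delta>. \<exists>\<kappa>\<in>elts \<delta>. \<alpha> \<in> elts \<kappa> \<and> subtle \<kappa>)"

section \<open>First-order structures as sets\<close>

record 'a signature =
  fun_syms :: "'a set"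
  fun_arity :: "'a \<Rightarrow> nat"
  rel_syms :: "'a set"
  rel_arity :: "'a \<Rightarrow> nat"

definition countable_signature :: "'a signature \<Rightarrow> bool" where
  "countable_signature \<sigma> \<longleftrightarrow> countable (fun_syms \<sigma>) \<and> countable (rel_syms \<sigma>)"

text \<open>A structure is a set \<open>(D, (F, R))\<close>, where \<open>D\<close> is its domain and \<open>F\<close> and \<open>R\<close> are functions on
  the function and relation symbols. The rank of such a set depends on how pairs and tuples are
  coded, but its membership in \<open>V \<delta>\<close> for limit \<open>\<delta>\<close> does not.\<close>

definition domain :: "'a::zermelo \<Rightarrow> 'a set" where
  "domain M = elts (THE D. \<exists>I. M = opair D I)"

definition funs :: "'a::zermelo \<Rightarrow> 'a" where
  "funs M = (THE F. \<exists>D R. M = opair D (opair F R))"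

definition rels :: "'a::zermelo \<Rightarrow> 'a" where
  "rels M = (THE R. \<exists>D F. M = opair D (opair F R))"

definition is_structure :: "'a::zermelo signature \<Rightarrow> 'a \<Rightarrow> bool" where
  "is_structure \<sigma> M \<longleftrightarrow>
     (\<exists>D F R. M = opair D (opair F R) \<and> elts D \<noteq> {} \<and>
        function_on F (fun_syms \<sigma>) \<and>
        (\<forall>f\<in>fun_syms \<sigma>. function_on (app F f) (tuples (elts D) (fun_arity \<sigma> f)) \<and>
           (\<forall>t\<in>tuples (elts D) (fun_arity \<sigma> f). app (app F f) t \<in> elts D)) \<and>
        function_on R (rel_syms \<sigma>) \<and>
        (\<forall>r\<in>rel_syms \<sigma>. elts (app R r) \<subseteq> tuples (elts D) (rel_arity \<sigma> r)))"

datatype 'a tm = Var nat | Fn 'a "'a tm list"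

datatype 'a fm =
    Equal "'a tm" "'a tm"
  | Rel 'a "'a tm list"
  | Neg "'a fm"
  | Conj "'a fm" "'a fm"
  | Exists nat "'a fm"

fun tm_over :: "'a signature \<Rightarrow> 'a tm \<Rightarrow> bool" where
  "tm_over \<sigma> (Var i) \<longleftrightarrow> True"
| "tm_over \<sigma> (Fn f ts) \<longleftrightarrow>
     f \<in> fun_syms \<sigma> \<and> length ts = fun_arity \<sigma> f \<and> (\<forall>t\<in>set ts. tm_over \<sigma> t)"

fun fm_over :: "'a signature \<Rightarrow> 'a fm \<Rightarrow> bool" where
  "fm_over \<sigma> (Equal t u) \<longleftrightarrow> tm_over \<sigma> t \<and> tm_over \<sigma> u"
| "fm_over \<sigma> (Rel r ts) \<longleftrightarrow>
     r \<in> rel_syms \<sigma> \<and> length ts = rel_arity \<sigma> r \<and> (\<forall>t\<in>set ts. tm_over \<sigma> t)"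
| "fm_over \<sigma> (Neg \<phi>) \<longleftrightarrow> fm_over \<sigma> \<phi>"
| "fm_over \<sigma> (Conj \<phi> \<psi>) \<longleftrightarrow> fm_over \<sigma> \<phi> \<and> fm_over \<sigma> \<psi>"
| "fm_over \<sigma> (Exists i \<phi>) \<longleftrightarrow> fm_over \<sigma> \<phi>"

fun tm_val :: "'a::zermelo \<Rightarrow> (nat \<Rightarrow> 'a) \<Rightarrow> 'a tm \<Rightarrow> 'a" where
  "tm_val M s (Var i) = s i"
| "tm_val M s (Fn f ts) = app (app (funs M) f) (tuple (map (tm_val M s) ts))"

fun sat :: "'a::zermelo \<Rightarrow> (nat \<Rightarrow> 'a) \<Rightarrow> 'a fm \<Rightarrow> bool" where
  "sat M s (Equal t u) \<longleftrightarrow> tm_val M s t = tm_val M s u"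
| "sat M s (Rel r ts) \<longleftrightarrow> tuple (map (tm_val M s) ts) \<in> elts (app (rels M) r)"
| "sat M s (Neg \<phi>) \<longleftrightarrow> \<not> sat M s \<phi>"
| "sat M s (Conj \<phi> \<psi>) \<longleftrightarrow> sat M s \<phi> \<and> sat M s \<psi>"
| "sat M s (Exists i \<phi>) \<longleftrightarrow> (\<exists>a\<in>domain M. sat M (s(i := a)) \<phi>)"

definition elementary_embedding ::
  "'a::zermelo signature \<Rightarrow> ('a \<Rightarrow> 'a) \<Rightarrow> 'a \<Rightarrow> 'a \<Rightarrow> bool" where
  "elementary_embedding \<sigma> h A B \<longleftrightarrow> h ` domain A \<subseteq> domain B \<and>
     (\<forall>\<phi> s. fm_over \<sigma> \<phi> \<and> range s \<subseteq> domain A \<longrightarrow> (sat A s \<phi> \<longleftrightarrow> sat B (h \<circ> s) \<phi>))"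

definition WSR :: "'a::zermelo signature \<Rightarrow> 'a \<Rightarrow> 'a \<Rightarrow> bool" where
  "WSR \<sigma> \<C> \<kappa> \<longleftrightarrow>
     (\<exists>A\<in>elts \<C>. domain A \<prec> elts \<kappa>) \<and>
     (\<forall>B\<in>elts \<C>. domain B \<approx> elts \<kappa> \<longrightarrow>
        (\<exists>A\<in>elts \<C>. domain A \<prec> elts \<kappa> \<and> (\<exists>h. elementary_embedding \<sigma> h A B)))"

end

theory Submission
  imports Defs
begin

text \<open>If \<open>\<delta>'\<close> is subtle and some structure in \<open>\<C>\<close> is smaller than \<open>\<delta>'\<close>, suppose that \<open>WSR\<close> fails at
  every cardinal below \<open>\<delta>'\<close> and choose a witness \<open>B \<kappa>\<close> with domain transferred to \<open>\<kappa>\<close>, for the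
  large cardinals \<open>\<kappa>\<close> in a club. Coding formulas with parameters by ordinals makes the
  elementary diagrams a list; two diagrams that agree give an elementary embedding of \<open>B \<beta>\<close> into
  \<open>B \<gamma>\<close>, a contradiction.

  Conversely, let no cardinal above \<open>\<alpha>\<close> up to and including \<open>\<delta>\<close> be subtle. Induction on \<open>\<delta>\<close> glues the
  witnesses of non-subtlety into one list \<open>G\<close> on the ordinals between \<open>\<alpha>\<close> and \<open>\<delta>\<close> such that
  \<open>G \<beta> = G \<gamma> \<inter> \<beta>\<close> never holds for \<open>\<beta> < \<gamma>\<close>. Let \<open>\<C>\<close> consist of the ordinals \<open>\<eta>\<close> in this interval with the order,
  the point \<open>\<alpha>\<close>, a ladder system, the relation \<open>x \<in> G y\<close> and the predicate \<open>G \<eta>\<close>. An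
  embedding of \<open>\<beta>\<close> into \<open>\<gamma>\<close> without critical point gives \<open>G \<beta> = G \<gamma> \<inter> \<beta>\<close>, one with critical
  point \<open>\<mu> > \<alpha>\<close> and value \<open>\<mu>'\<close> gives \<open>G \<mu> = G \<mu>' \<inter> \<mu>\<close>, and the ladders exclude critical points
  below \<open>\<alpha>\<close>.\<close>

section \<open>Sets, ordinals and cardinals\<close>

text \<open>These are the HOL sets that are extensions of sets, the only ones on which
  \<open>set_of\<close> is meaningful. Without replacement, an image or an indexed union has to be
  bounded by a set before it is known to be small.\<close>

definition small :: "'a::zermelo set \<Rightarrow> bool" where
  "small X \<longleftrightarrow> (\<exists>x. elts x = X)"

lemma elts_set_of [simp]: "small X \<Longrightarrow> elts (set_of X) = X"
  unfolding small_def set_of_def by (metis (mono_tags) extensionality theI)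

lemma set_of_elts [simp]: "set_of (elts x) = x"
  by (rule extensionality, rule elts_set_of) (auto simp: small_def)

lemma small_elts [simp]: "small (elts x)"
  by (auto simp: small_def)

lemma small_subset: "small Y \<Longrightarrow> X \<subseteq> Y \<Longrightarrow> small X"
proof -
  assume "small Y" "X \<subseteq> Y"
  then obtain y where "elts y = Y" by (auto simp: small_def)
  moreover obtain x where "elts x = {z \<in> elts y. z \<in> X}" using separation by metis
  ultimately have "elts x = X" using \<open>X \<subseteq> Y\<close> by auto
  then show ?thesis by (auto simp: small_def)
qed

lemma small_pair [simp]: "small {x, y}"
  using pairing by (simp add: small_def)

lemma small_singleton [simp]: "small {x}"
  using small_pair[of x x] by simp

lemma small_empty [simp]: "small {}"
  by (rule small_subset[OF small_singleton]) auto

lemma small_insert [simp]: "small X \<Longrightarrow> small (insert x X)"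
proof -
  assume "small X"
  then obtain y where y: "elts y = X" by (auto simp: small_def)
  have "(\<Union>u\<in>elts (set_of {set_of {x}, y}). elts u) = insert x X" by (simp add: y)
  then show ?thesis unfolding small_def using union by metis
qed

lemma elts_succ [simp]: "elts (succ x) = insert x (elts x)"
  by (simp add: succ_def)

lemma set_of_inject: "small X \<Longrightarrow> small Y \<Longrightarrow> set_of X = set_of Y \<longleftrightarrow> X = Y"
  using elts_set_of by metis

lemma opair_inject [simp]: "opair a b = opair c d \<longleftrightarrow> a = c \<and> b = d"
proof -
  have "opair a b = opair c d \<longleftrightarrow> {set_of {a}, set_of {a, b}} = {set_of {c}, set_of {c, d}}"
    unfolding opair_def by (intro set_of_inject small_pair)
  also have "\<dots> \<longleftrightarrow> {a} = {c} \<and> {a, b} = {c, d} \<or> {a} = {c, d} \<and> {a, b} = {c}"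
    by (subst doubleton_eq_iff) (simp only: set_of_inject small_pair small_singleton)
  also have "\<dots> \<longleftrightarrow> a = c \<and> b = d"
    by (auto simp: doubleton_eq_iff)
  finally show ?thesis .
qed

section \<open>Foundation and ordinals\<close>

lemma elts_induct [case_names step]:
  assumes "\<And>x::'a::zermelo. (\<And>y. y \<in> elts x \<Longrightarrow> P y) \<Longrightarrow> P x"
  shows "P a"
proof (rule wf_induct_rule[OF foundation])
  fix x :: 'a assume "\<And>y. (y, x) \<in> {(x, y). x \<in> elts y} \<Longrightarrow> P y"
  then show "P x" using assms[of x] by simp
qed

lemma mem_asym: "x \<in> elts y \<Longrightarrow> y \<notin> elts (x :: 'a::zermelo)"
  using wf_not_sym[OF foundation, of x y] by simp

lemma mem_not_refl [simp]: "x \<notin> elts (x :: 'a::zermelo)"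
  using mem_asym[of x x] by blast

lemma Ord_mem: "Ord \<alpha> \<Longrightarrow> x \<in> elts \<alpha> \<Longrightarrow> Ord x"
  unfolding Ord_def by blast

lemma Ord_trans: "Ord \<alpha> \<Longrightarrow> x \<in> elts y \<Longrightarrow> y \<in> elts \<alpha> \<Longrightarrow> x \<in> elts \<alpha>"
  unfolding Ord_def by blast

lemma Ord_transD: "Ord \<alpha> \<Longrightarrow> y \<in> elts \<alpha> \<Longrightarrow> elts y \<subseteq> elts \<alpha>"
  unfolding Ord_def by blast

lemma Ord_linear:
  assumes "Ord (\<alpha> :: 'a::zermelo)" "Ord \<beta>"
  shows "\<alpha> \<in> elts \<beta> \<or> \<alpha> = \<beta> \<or> \<beta> \<in> elts \<alpha>"
  using assms
proof (induction \<alpha> arbitrary: \<beta> rule: elts_induct)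
  case (step \<alpha>)
  note IH = step.IH and \<alpha> = step.prems(1)
  show ?case using step.prems(2)
  proof (induction \<beta> rule: elts_induct)
    case (step \<beta>)
    show ?case
    proof (rule ccontr)
      assume neg: "\<not> ?thesis"
      have "elts \<alpha> \<subseteq> elts \<beta>"
        using IH[OF _ Ord_mem[OF \<alpha>] step.prems] neg Ord_trans[OF \<alpha>] by blast
      moreover have "elts \<beta> \<subseteq> elts \<alpha>"
        using step.IH[OF _ Ord_mem[OF step.prems]] neg Ord_trans[OF step.prems] by blast
      ultimately show False using neg extensionality by blast
    qed
  qed
qed

lemma Ord_subset_iff:
  "Ord (\<alpha> :: 'a::zermelo) \<Longrightarrow> Ord \<beta> \<Longrightarrow> elts \<alpha> \<subseteq> elts \<beta> \<longleftrightarrow> \<alpha> = \<beta> \<or> \<alpha> \<in> elts \<beta>"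
  using Ord_linear[of \<alpha> \<beta>] Ord_transD[of \<beta> \<alpha>] by auto

lemma Ord_cases:
  assumes "Ord (\<alpha> :: 'a::zermelo)" "Ord \<beta>"
  obtains "\<alpha> \<in> elts \<beta>" | "\<alpha> = \<beta>" | "\<beta> \<in> elts \<alpha>"
  using Ord_linear[OF assms] by blast

lemma Ord_not_mem: "Ord (\<alpha> :: 'a::zermelo) \<Longrightarrow> Ord \<beta> \<Longrightarrow> \<alpha> \<notin> elts \<beta> \<longleftrightarrow> elts \<beta> \<subseteq> elts \<alpha>"
  using Ord_linear[of \<alpha> \<beta>] Ord_transD[of \<alpha> \<beta>] by auto

lemma Ord_least:
  assumes "P (a :: 'a::zermelo)" "\<And>x. P x \<Longrightarrow> Ord x"
  obtains m where "P m" "\<And>y. P y \<Longrightarrow> m = y \<or> m \<in> elts y" "\<And>y. y \<in> elts m \<Longrightarrow> \<not> P y"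
proof -
  obtain m where m: "P m" "\<And>y. y \<in> elts m \<Longrightarrow> \<not> P y"
    using wfE_min[OF foundation, of a "{x. P x}"] assms(1) by auto
  then show ?thesis using that Ord_linear assms(2) by metis
qed

lemma Ord_least_image:
  assumes "P a" "\<And>x. P x \<Longrightarrow> Ord (f x :: 'a::zermelo)"
  shows "\<exists>m. P m \<and> (\<forall>y. P y \<longrightarrow> f m = f y \<or> f m \<in> elts (f y))"
proof -
  have "\<exists>x. P x \<and> f a = f x" using assms(1) by blast
  then obtain z where "\<exists>x. P x \<and> z = f x" "\<And>y. \<exists>x. P x \<and> y = f x \<Longrightarrow> z = y \<or> z \<in> elts y"
    by (rule Ord_least[of "\<lambda>z. \<exists>x. P x \<and> z = f x" "f a"]) (use assms(2) in blast)+
  then show ?thesis by blast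
qed

lemma Ord_succ: "Ord \<alpha> \<Longrightarrow> Ord (succ \<alpha>)"
  by (auto simp: Ord_def)

lemma Ord_Union:
  assumes "elts u = (\<Union>x\<in>X. elts x)" "\<And>x. x \<in> X \<Longrightarrow> Ord x"
  shows "Ord u"
  using assms by (fastforce simp: Ord_def)

section \<open>Cardinals and finite ordinals\<close>

lemma CardD: "Card \<kappa> \<Longrightarrow> Ord \<kappa>" by (simp add: Card_def)

lemma Card_lesspoll:
  assumes "Card \<kappa>" "\<alpha> \<in> elts \<kappa>" shows "elts \<alpha> \<prec> elts \<kappa>"
  using assms Ord_transD[of \<kappa> \<alpha>] by (auto simp: Card_def lesspoll_def subset_imp_lepoll)

lemma Card_lesspoll_iff:
  assumes "Card \<kappa>" "Ord \<alpha>" shows "elts \<alpha> \<prec> elts \<kappa> \<longleftrightarrow> \<alpha> \<in> elts \<kappa>"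
proof
  assume "elts \<alpha> \<prec> elts \<kappa>"
  then have "\<not> elts \<kappa> \<subseteq> elts \<alpha>"
    using lesspoll_trans2 subset_imp_lepoll by blast
  then show "\<alpha> \<in> elts \<kappa>" using Ord_not_mem[OF assms(2) CardD[OF assms(1)]] by blast
qed (rule Card_lesspoll[OF assms(1)])

lemma finite_Ord_max:
  assumes "Ord (\<alpha> :: 'a::zermelo)" "finite (elts \<alpha>)" "elts \<alpha> \<noteq> {}"
  obtains \<mu> where "elts \<alpha> = insert \<mu> (elts \<mu>)"
proof -
  have "\<exists>m\<in>X. \<forall>y\<in>X. y = m \<or> y \<in> elts m" if "finite X" "X \<noteq> {}" "X \<subseteq> elts \<alpha>" for X
    using that
  proof (induction X rule: finite_ne_induct)
    case (insert x X)
    then obtain m where m: "m \<in> X" "\<forall>y\<in>X. y = m \<or> y \<in> elts m" by auto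
    have "Ord x" "Ord m" using insert.prems m(1) by (auto intro: Ord_mem[OF assms(1)])
    then consider "x \<in> elts m" | "x = m" | "m \<in> elts x" by (rule Ord_cases)
    then show ?case
    proof cases
      case 3
      then have "\<forall>y\<in>insert x X. y = x \<or> y \<in> elts x" using m Ord_trans[OF \<open>Ord x\<close>] by auto
      then show ?thesis by blast
    qed (use m in auto)
  qed auto
  then obtain m where m: "m \<in> elts \<alpha>" "\<forall>y\<in>elts \<alpha>. y = m \<or> y \<in> elts m"
    using assms by (meson order_refl)
  then show ?thesis using that[of m] Ord_transD[OF assms(1), of m] by auto
qed

text \<open>Adding one point to an infinite set does not change its cardinality, so an infinite
  cardinal is never a successor ordinal.\<close>

lemma infinite_Card_limit:
  assumes "Card \<kappa>" "infinite (elts \<kappa>)" "\<alpha> \<in> elts \<kappa>"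
  shows "succ \<alpha> \<in> elts \<kappa>"
proof -
  have o: "Ord \<alpha>" "Ord \<kappa>" using assms CardD Ord_mem by auto
  have "succ \<alpha> \<noteq> \<kappa>"
  proof
    assume "succ \<alpha> = \<kappa>"
    then have k: "elts \<kappa> = insert \<alpha> (elts \<alpha>)" by auto
    then have "infinite (elts \<alpha>)" using assms by simp
    then have "elts \<kappa> \<approx> elts \<alpha>" unfolding k by (rule infinite_insert_eqpoll)
    then show False using assms eqpoll_sym by (auto simp: Card_def)
  qed
  moreover have "elts (succ \<alpha>) \<subseteq> elts \<kappa>" using assms Ord_transD[OF o(2)] by simp
  ultimately show ?thesis using Ord_subset_iff[OF Ord_succ[OF o(1)] o(2)] by blast
qed

section \<open>Ranks in the cumulative hierarchy\<close>

lemma mem_V: "x \<in> V \<alpha> \<longleftrightarrow> (\<exists>\<beta>\<in>elts \<alpha>. elts x \<subseteq> V \<beta>)"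
  unfolding V_def by (subst mem_Collect_eq, subst in_V.simps) blast

lemma V_mono: "elts \<alpha> \<subseteq> elts \<beta> \<Longrightarrow> V \<alpha> \<subseteq> V \<beta>"
proof
  fix x assume "elts \<alpha> \<subseteq> elts \<beta>" "x \<in> V \<alpha>"
  then show "x \<in> V \<beta>" using mem_V[of x \<alpha>] mem_V[of x \<beta>] by blast
qed

lemma V_mono_mem: "Ord \<beta> \<Longrightarrow> \<alpha> \<in> elts \<beta> \<Longrightarrow> V \<alpha> \<subseteq> V \<beta>"
  by (rule V_mono) (rule Ord_transD)

lemma V_transitive: "Ord \<alpha> \<Longrightarrow> x \<in> V \<alpha> \<Longrightarrow> y \<in> elts x \<Longrightarrow> y \<in> V \<alpha>"
  using V_mono_mem mem_V[of x \<alpha>] by blast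

lemma V_succ: "Ord \<alpha> \<Longrightarrow> x \<in> V (succ \<alpha>) \<longleftrightarrow> elts x \<subseteq> V \<alpha>"
  using V_mono_mem[of \<alpha>] mem_V[of x "succ \<alpha>"] by auto

lemma small_V: "Ord \<alpha> \<Longrightarrow> small (V (\<alpha> :: 'a::cumulative))"
  using V_is_set by (auto simp: small_def)

lemma Ord_not_in_V: "Ord (\<alpha> :: 'a::zermelo) \<Longrightarrow> \<alpha> \<notin> V \<alpha>"
proof (induction \<alpha> rule: elts_induct)
  case (step \<alpha>)
  then show ?case using Ord_mem[of \<alpha>] mem_V[of \<alpha> \<alpha>] by blast
qed

lemma Ord_subset_V: "Ord (\<alpha> :: 'a::zermelo) \<Longrightarrow> elts \<alpha> \<subseteq> V \<alpha>"
proof (induction \<alpha> rule: elts_induct)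
  case (step \<alpha>)
  show ?case
  proof
    fix x assume "x \<in> elts \<alpha>"
    then show "x \<in> V \<alpha>" using step Ord_mem[of \<alpha> x] mem_V[of x \<alpha>] by blast
  qed
qed

lemma opair_in_V:
  assumes "Ord \<alpha>" "x \<in> V \<alpha>" "y \<in> V \<alpha>" shows "opair x y \<in> V (succ (succ \<alpha>))"
  unfolding opair_def using assms by (auto simp: V_succ Ord_succ)

lemma fst_in_V:
  assumes "Ord \<alpha>" "opair x y \<in> V \<alpha>" shows "x \<in> V \<alpha>"
proof -
  have "set_of {x} \<in> elts (opair x y)" "x \<in> elts (set_of {x})" by (simp_all add: opair_def)
  then show ?thesis using assms V_transitive by blast
qed

section \<open>Lists without coherent pairs\<close>

text \<open>A list entry is a sequence of sets rather than a single set: the countably many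
  coordinates leave room to prepend markers whenever lists are glued.\<close>

definition coherent :: "('a::zermelo \<Rightarrow> nat \<Rightarrow> 'a set) \<Rightarrow> 'a \<Rightarrow> 'a \<Rightarrow> bool" where
  "coherent G \<beta> \<gamma> \<longleftrightarrow> (\<forall>n. G \<beta> n \<inter> elts \<beta> = G \<gamma> n \<inter> elts \<beta>)"

lemma coherentD: "coherent G \<beta> \<gamma> \<Longrightarrow> G \<beta> n \<inter> elts \<beta> = G \<gamma> n \<inter> elts \<beta>"
  by (simp add: coherent_def)

text \<open>Only pairs above \<open>\<alpha>\<close> count, so that the marker
  \<open>{\<alpha>}\<close> is contained in both ordinals and survives every intersection with
  \<open>\<beta>\<close>.\<close>

definition incoherent :: "('a::zermelo \<Rightarrow> nat \<Rightarrow> 'a set) \<Rightarrow> 'a \<Rightarrow> 'a \<Rightarrow> bool" where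
  "incoherent G \<alpha> \<delta> \<longleftrightarrow>
     (\<forall>\<gamma>\<in>elts \<delta>. \<forall>\<beta>\<in>elts \<gamma>. \<alpha> \<in> elts \<beta> \<longrightarrow> \<not> coherent G \<beta> \<gamma>)"

lemma incoherentD:
  "incoherent G \<alpha> \<delta> \<Longrightarrow> \<alpha> \<in> elts \<beta> \<Longrightarrow> \<beta> \<in> elts \<gamma> \<Longrightarrow> \<gamma> \<in> elts \<delta> \<Longrightarrow> \<not> coherent G \<beta> \<gamma>"
  by (auto simp: incoherent_def)

text \<open>Coordinate 0 separates the new top \<open>\<eta>\<close> from everything below it; the
  shifted coordinates of \<open>G\<close> settle the pairs below \<open>\<eta>\<close>.\<close>

lemma incoherent_successor:
  assumes "elts \<delta> = insert \<eta> (elts \<eta>)" "Ord \<delta>" "incoherent G \<alpha> \<eta>"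
  shows "\<exists>G. incoherent G \<alpha> \<delta>"
proof -
  define H where "H \<mu> = case_nat (if \<mu> = \<eta> then {} else {\<alpha>}) (G \<mu>)" for \<mu>
  have "\<not> coherent H \<beta> \<gamma>" if \<gamma>: "\<gamma> \<in> elts \<delta>" and \<beta>: "\<beta> \<in> elts \<gamma>" "\<alpha> \<in> elts \<beta>" for \<beta> \<gamma>
  proof
    assume coh: "coherent H \<beta> \<gamma>"
    have "\<beta> \<noteq> \<eta>"
      using \<gamma> \<beta> assms(1) mem_asym[of \<beta> \<gamma>] by auto
    then have "H \<beta> 0 = {\<alpha>}" by (simp add: H_def)
    then have "\<gamma> \<noteq> \<eta>" using coherentD[OF coh, of 0] \<beta>(2) by (auto simp: H_def)
    then have "\<gamma> \<in> elts \<eta>" using \<gamma> assms(1) by auto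
    then have "\<not> coherent G \<beta> \<gamma>" using incoherentD[OF assms(3)] \<beta> by blast
    then obtain n where "G \<beta> n \<inter> elts \<beta> \<noteq> G \<gamma> n \<inter> elts \<beta>" by (auto simp: coherent_def)
    then have "H \<beta> (Suc n) \<inter> elts \<beta> \<noteq> H \<gamma> (Suc n) \<inter> elts \<beta>" by (simp add: H_def)
    then show False using coherentD[OF coh] by blast
  qed
  then show ?thesis by (auto simp: incoherent_def)
qed

text \<open>Coordinate 0 separates the ordinals below \<open>\<nu>\<close>, where \<open>G\<close>
  does the work, from the others. Above \<open>\<nu>\<close>, coordinate 1 stores the injective
  label \<open>g \<mu>\<close>; being below \<open>\<nu>\<close>, it is seen by every later
  ordinal.\<close>

lemma incoherent_not_Card:
  assumes "Ord \<delta>" "\<nu> \<in> elts \<delta>" "inj_on g (elts \<delta>)" "g ` elts \<delta> \<subseteq> elts \<nu>" "incoherent G \<alpha> \<nu>"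
  shows "\<exists>G. incoherent G \<alpha> \<delta>"
proof -
  define H where "H \<mu> =
    case_nat (if \<mu> \<in> elts \<nu> then {\<alpha>} else {})
      (case_nat (if \<nu> \<in> elts \<mu> then {g \<mu>} else {}) (G \<mu>))" for \<mu>
  have "\<not> coherent H \<beta> \<gamma>" if \<gamma>: "\<gamma> \<in> elts \<delta>" and \<beta>: "\<beta> \<in> elts \<gamma>" "\<alpha> \<in> elts \<beta>" for \<beta> \<gamma>
  proof
    assume coh: "coherent H \<beta> \<gamma>"
    have o: "Ord \<gamma>" "Ord \<beta>" "Ord \<nu>" using assms(1,2) \<gamma> \<beta> Ord_mem by blast+
    have \<beta>\<delta>: "\<beta> \<in> elts \<delta>" using assms(1) \<gamma> \<beta> Ord_trans by blast
    show False
    proof (cases rule: Ord_cases[OF o(2,3)])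
      case 1
      then have "H \<beta> 0 = {\<alpha>}" by (simp add: H_def)
      then have "\<gamma> \<in> elts \<nu>"
        using coherentD[OF coh, of 0] \<beta>(2) by (auto simp: H_def split: if_splits)
      then have "\<not> coherent G \<beta> \<gamma>" using incoherentD[OF assms(5)] \<beta> by blast
      then obtain n where "G \<beta> n \<inter> elts \<beta> \<noteq> G \<gamma> n \<inter> elts \<beta>" by (auto simp: coherent_def)
      then have "H \<beta> (Suc (Suc n)) \<inter> elts \<beta> \<noteq> H \<gamma> (Suc (Suc n)) \<inter> elts \<beta>" by (simp add: H_def)
      then show False using coherentD[OF coh] by blast
    next
      case 2
      \<comment> \<open>The point \<open>\<nu>\<close> itself carries no label, which distinguishes
        it from all larger ordinals.\<close>
      then have "H \<beta> 1 = {}" "H \<gamma> 1 = {g \<gamma>}" using \<beta> by (simp_all add: H_def)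
      moreover have "g \<gamma> \<in> elts \<beta>" using 2 assms(4) \<gamma> by blast
      ultimately show False using coherentD[OF coh, of 1] by auto
    next
      case 3
      then have "\<nu> \<in> elts \<gamma>" using Ord_trans o \<beta> by blast
      then have "H \<beta> 1 = {g \<beta>}" "H \<gamma> 1 = {g \<gamma>}" using 3 by (simp_all add: H_def)
      moreover have "g \<beta> \<in> elts \<beta>" using 3 assms(4) \<beta>\<delta> Ord_trans[OF o(2)] by blast
      ultimately have "g \<beta> = g \<gamma>" using coherentD[OF coh, of 1] by auto
      then show False using assms(3) \<gamma> \<beta> \<beta>\<delta> mem_not_refl by (metis inj_onD)
    qed
  qed
  then show ?thesis by (auto simp: incoherent_def)
qed

text \<open>The list \<open>E\<close> settles the pairs inside the club \<open>C\<close>, and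
  coordinate 0 separates \<open>C\<close> from its complement. Off \<open>C\<close>, coordinate 1
  forces both ordinals into the same gap of \<open>C\<close>, where the list belonging to the upper
  end of that gap settles the pair.\<close>

lemma incoherent_not_subtle:
  assumes "Ord \<delta>" "ordinal_list \<delta> E" "closed_unbounded C \<delta>"
    and bad: "\<And>\<beta> \<gamma>. \<beta> \<in> elts C \<Longrightarrow> \<gamma> \<in> elts C \<Longrightarrow> \<beta> \<in> elts \<gamma> \<Longrightarrow> elts (E \<beta>) \<noteq> elts (E \<gamma>) \<inter> elts \<beta>"
    and G: "\<And>\<eta>. \<eta> \<in> elts \<delta> \<Longrightarrow> incoherent (G \<eta>) \<alpha> \<eta>"
  shows "\<exists>G. incoherent G \<alpha> \<delta>"
proof -
  have C: "elts C \<subseteq> elts \<delta>" "\<And>\<mu>. \<mu> \<in> elts \<delta> \<Longrightarrow> \<exists>\<beta>\<in>elts C. \<mu> \<in> elts \<beta>"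
    using assms(3) by (auto simp: closed_unbounded_def)
  have oC: "Ord c" if "c \<in> elts C" for c using that C(1) assms(1) Ord_mem by blast
  have "\<exists>c. c \<in> elts C \<and> \<mu> \<in> elts c \<and> (\<forall>c'\<in>elts C. \<mu> \<in> elts c' \<longrightarrow> c = c' \<or> c \<in> elts c')"
    if "\<mu> \<in> elts \<delta>" for \<mu>
  proof -
    obtain c where "c \<in> elts C \<and> \<mu> \<in> elts c" using C(2) \<open>\<mu> \<in> elts \<delta>\<close> by blast
    then show ?thesis
      by (rule Ord_least[where P = "\<lambda>c. c \<in> elts C \<and> \<mu> \<in> elts c"]) (use oC in blast)+
  qed
  \<comment> \<open>\<open>nx \<mu>\<close> is the first point of \<open>C\<close> above
    \<open>\<mu>\<close>, the upper end of its gap.\<close>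
  then obtain nx where nx: "\<And>\<mu>. \<mu> \<in> elts \<delta> \<Longrightarrow> nx \<mu> \<in> elts C \<and> \<mu> \<in> elts (nx \<mu>) \<and>
      (\<forall>c'\<in>elts C. \<mu> \<in> elts c' \<longrightarrow> nx \<mu> = c' \<or> nx \<mu> \<in> elts c')"
    by metis
  \<comment> \<open>The final segment of \<open>\<mu>\<close> at or above all points of
    \<open>C\<close> below \<open>\<mu>\<close>. It moves up as soon as \<open>C\<close> has another
    point below \<open>\<mu>\<close>.\<close>
  define D where "D \<mu> = {\<xi> \<in> elts \<mu>. \<forall>c\<in>elts C \<inter> elts \<mu>. \<xi> \<notin> elts c}" for \<mu>
  define H where "H \<mu> = case_nat (if \<mu> \<in> elts C then {\<alpha>} else {})
      (case_nat (if \<mu> \<in> elts C then elts (E \<mu>) else D \<mu>) (G (nx \<mu>) \<mu>))" for \<mu>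
  have "\<not> coherent H \<beta> \<gamma>" if \<gamma>: "\<gamma> \<in> elts \<delta>" and \<beta>: "\<beta> \<in> elts \<gamma>" "\<alpha> \<in> elts \<beta>" for \<beta> \<gamma>
  proof
    assume coh: "coherent H \<beta> \<gamma>"
    have o: "Ord \<gamma>" "Ord \<beta>" using assms(1) \<gamma> \<beta> Ord_mem by blast+
    have \<beta>\<delta>: "\<beta> \<in> elts \<delta>" using assms(1) \<gamma> \<beta> Ord_trans by blast
    have "H \<beta> 0 \<inter> elts \<beta> = H \<gamma> 0 \<inter> elts \<beta>" and H1: "H \<beta> 1 \<inter> elts \<beta> = H \<gamma> 1 \<inter> elts \<beta>"
      by (rule coherentD[OF coh])+
    then have iff: "\<beta> \<in> elts C \<longleftrightarrow> \<gamma> \<in> elts C" using \<beta> by (auto simp: H_def split: if_splits)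
    show False
    proof (cases "\<beta> \<in> elts C")
      case True
      moreover have "elts (E \<beta>) \<subseteq> elts \<beta>" using assms(2) \<beta>\<delta> by (simp add: ordinal_list_def)
      ultimately show False using bad[of \<beta> \<gamma>] \<beta> iff H1 by (auto simp: H_def)
    next
      case False
      have "elts \<beta> \<noteq> {}" using \<beta> by blast
      \<comment> \<open>Since \<open>C\<close> is closed, a point outside \<open>C\<close> is not a
        limit of \<open>C\<close>, so the segment is nonempty.\<close>
      then have ne: "D \<beta> \<noteq> {}"
        using False assms(3) \<beta>\<delta> by (auto simp: closed_unbounded_def D_def)
      have DD: "D \<beta> = D \<gamma> \<inter> elts \<beta>" using H1 False iff by (auto simp: H_def D_def)
      \<comment> \<open>A point of \<open>C\<close> between \<open>\<beta>\<close> and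
        \<open>\<gamma>\<close> would lie above the elements of \<open>D \<beta>\<close>, which also
        belong to \<open>D \<gamma>\<close>.\<close>
      have gap: "c \<notin> elts \<gamma>" if "c \<in> elts C" "\<beta> \<in> elts c" for c
      proof
        assume "c \<in> elts \<gamma>"
        obtain \<xi> where "\<xi> \<in> D \<gamma>" "\<xi> \<in> elts \<beta>" using ne DD by blast
        moreover have "\<xi> \<in> elts c" using \<open>\<xi> \<in> elts \<beta>\<close> that Ord_trans oC by blast
        ultimately show False using \<open>c \<in> elts C\<close> \<open>c \<in> elts \<gamma>\<close> by (auto simp: D_def)
      qed
      have n\<beta>: "nx \<beta> \<in> elts C" "\<beta> \<in> elts (nx \<beta>)"
        and n\<gamma>: "nx \<gamma> \<in> elts C" "\<gamma> \<in> elts (nx \<gamma>)" using nx \<gamma> \<beta>\<delta> by blast+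
      have "\<gamma> \<noteq> nx \<beta>" using n\<beta> iff False by blast
      then have g: "\<gamma> \<in> elts (nx \<beta>)"
        using Ord_linear[OF o(1) oC[OF n\<beta>(1)]] gap[OF n\<beta>] by blast
      have "\<beta> \<in> elts (nx \<gamma>)" using \<beta> n\<gamma> Ord_trans oC by blast
      then have "nx \<beta> = nx \<gamma> \<or> nx \<beta> \<in> elts (nx \<gamma>)" using nx[OF \<beta>\<delta>] n\<gamma> by blast
      moreover have "nx \<gamma> = nx \<beta> \<or> nx \<gamma> \<in> elts (nx \<beta>)" using nx[OF \<gamma>] n\<beta> g by blast
      ultimately have eq: "nx \<gamma> = nx \<beta>" by (auto dest: mem_asym)
      have "\<not> coherent (G (nx \<beta>)) \<beta> \<gamma>"
        using incoherentD[OF G \<beta>(2,1) g] n\<beta> C by blast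
      then obtain n where "G (nx \<beta>) \<beta> n \<inter> elts \<beta> \<noteq> G (nx \<beta>) \<gamma> n \<inter> elts \<beta>" by (auto simp: coherent_def)
      then have "H \<beta> (Suc (Suc n)) \<inter> elts \<beta> \<noteq> H \<gamma> (Suc (Suc n)) \<inter> elts \<beta>" by (simp add: H_def eq)
      then show False using coherentD[OF coh] by blast
    qed
  qed
  then show ?thesis by (auto simp: incoherent_def)
qed

text \<open>Induction on \<open>\<delta>\<close>: lists for smaller ordinals are glued by one of the
  three preceding constructions, according to the reason why \<open>\<delta>\<close> is not
  subtle.\<close>

lemma incoherent_exists:
  assumes "Ord (\<delta> :: 'a::zermelo)"
    and "\<And>\<kappa>. \<kappa> = \<delta> \<or> \<kappa> \<in> elts \<delta> \<Longrightarrow> \<alpha> \<in> elts \<kappa> \<Longrightarrow> \<not> subtle \<kappa>"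
  shows "\<exists>G. incoherent G \<alpha> \<delta>"
  using assms
proof (induction \<delta> rule: elts_induct)
  case (step \<delta>)
  have IH: "\<exists>G. incoherent G \<alpha> \<eta>" if "\<eta> \<in> elts \<delta>" for \<eta>
    using step.IH[OF that Ord_mem[OF step.prems(1) that]] that step.prems Ord_trans by blast
  \<comment> \<open>A nonempty finite ordinal is a successor. What remains is an infinite cardinal
    above \<open>\<alpha>\<close>, to which the non-subtlety hypothesis applies.\<close>
  consider (0) "\<alpha> \<notin> elts \<delta>" | (1) \<eta> where "elts \<delta> = insert \<eta> (elts \<eta>)"
    | (2) "\<not> Card \<delta>" | (3) "\<alpha> \<in> elts \<delta>" "Card \<delta>" "infinite (elts \<delta>)"
    using finite_Ord_max[OF step.prems(1)] by blast
  then show ?case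
  proof cases
    case 0
    then show ?thesis using Ord_trans[OF step.prems(1)] by (auto simp: incoherent_def)
  next
    case (1 \<eta>)
    then obtain G where "incoherent G \<alpha> \<eta>" using IH by blast
    then show ?thesis by (rule incoherent_successor[OF 1 step.prems(1)])
  next
    case 2
    then obtain \<nu> where \<nu>: "\<nu> \<in> elts \<delta>" "elts \<nu> \<approx> elts \<delta>"
      using step.prems(1) by (auto simp: Card_def)
    then obtain g where "bij_betw g (elts \<delta>) (elts \<nu>)"
      using eqpoll_sym unfolding eqpoll_def by blast
    then show ?thesis
      using incoherent_not_Card[OF step.prems(1) \<nu>(1), of g] IH[OF \<nu>(1)]
      by (auto simp: bij_betw_def)
  next
    case 3
    then have "\<not> subtle \<delta>" using step.prems(2) by blast
    then obtain E C where "ordinal_list \<delta> E" "closed_unbounded C \<delta>"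
      "\<And>\<beta> \<gamma>. \<beta> \<in> elts C \<Longrightarrow> \<gamma> \<in> elts C \<Longrightarrow> \<beta> \<in> elts \<gamma> \<Longrightarrow> elts (E \<beta>) \<noteq> elts (E \<gamma>) \<inter> elts \<beta>"
      using 3 unfolding subtle_def by blast
    moreover obtain G where "\<And>\<eta>. \<eta> \<in> elts \<delta> \<Longrightarrow> incoherent (G \<eta>) \<alpha> \<eta>" using IH by metis
    ultimately show ?thesis by (rule incoherent_not_subtle[OF step.prems(1)])
  qed
qed

section \<open>Ladders and critical points\<close>

definition is_ladder :: "'a::zermelo \<Rightarrow> (nat \<Rightarrow> 'a) \<Rightarrow> bool" where
  "is_ladder \<xi> l \<longleftrightarrow> (\<forall>n. l n \<in> elts \<xi>) \<and> (\<forall>x\<in>elts \<xi>. \<exists>n. x \<in> elts (l n))"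

text \<open>An ordinal has a ladder only if it is a limit of cofinality \<omega>. Elsewhere the
  chosen value is arbitrary, so every use is guarded by
  \<open>is_ladder \<xi> (ladder \<xi>)\<close>.\<close>

definition ladder :: "'a::zermelo \<Rightarrow> nat \<Rightarrow> 'a" where
  "ladder \<xi> = (SOME l. is_ladder \<xi> l)"

lemma is_ladder_ladder: "is_ladder \<xi> l \<Longrightarrow> is_ladder \<xi> (ladder \<xi>)"
  unfolding ladder_def by (rule someI[of "is_ladder \<xi>"])

text \<open>Ladders rule out critical points below the fixed point \<open>\<alpha>\<close>: the supremum \<open>\<xi>\<close> of the critical
  sequence would be fixed together with every rung of its ladder, although \<open>h\<close> moves every ordinal
  between the critical point and \<open>\<xi>\<close>.\<close>

lemma critical_point_above:
  assumes \<beta>: "Ord \<beta>" "Ord \<gamma>" "\<alpha> \<in> elts \<beta>"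
    and h: "\<And>x. x \<in> elts \<beta> \<Longrightarrow> h x \<in> elts \<gamma>"
    and mono: "\<And>x y. x \<in> elts \<beta> \<Longrightarrow> y \<in> elts \<beta> \<Longrightarrow> x \<in> elts y \<Longrightarrow> h x \<in> elts (h y)"
    and fixed: "h \<alpha> = \<alpha>"
    and lad: "\<And>\<xi> n. \<xi> \<in> elts \<beta> \<Longrightarrow> is_ladder \<xi> (ladder \<xi>) \<Longrightarrow>
        is_ladder (h \<xi>) (ladder (h \<xi>)) \<and> h (ladder \<xi> n) = ladder (h \<xi>) n"
    and \<mu>: "\<mu> \<in> elts \<beta>" "\<mu> \<in> elts (h \<mu>)"
  shows "\<alpha> \<in> elts \<mu>"
proof (rule ccontr)
  assume neg: "\<alpha> \<notin> elts \<mu>"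
  have o: "Ord \<alpha>" "Ord \<mu>" using \<beta> \<mu> Ord_mem by blast+
  have "\<mu> \<noteq> \<alpha>" using \<mu> fixed by auto
  then have \<mu>\<alpha>: "\<mu> \<in> elts \<alpha>" using neg Ord_linear o by blast
  \<comment> \<open>The critical sequence. It stays below \<open>\<alpha>\<close> because
    \<open>h\<close> fixes \<open>\<alpha>\<close> and preserves membership.\<close>
  define m where "m n = (h ^^ n) \<mu>" for n
  have \<alpha>\<beta>: "x \<in> elts \<beta>" if "x \<in> elts \<alpha>" for x using that \<beta> Ord_trans by blast
  have m\<alpha>: "m n \<in> elts \<alpha>" for n
    by (induction n) (use \<mu>\<alpha> mono[OF \<alpha>\<beta> \<beta>(3)] fixed in \<open>auto simp: m_def\<close>)
  have m_Suc: "m (Suc n) = h (m n)" for n by (simp add: m_def)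
  have m_step: "m n \<in> elts (m (Suc n))" for n
  proof (induction n)
    case 0 then show ?case using \<mu> by (simp add: m_def)
  next
    case (Suc n)
    then show ?case using mono[OF \<alpha>\<beta>[OF m\<alpha>] \<alpha>\<beta>[OF m\<alpha>]] m_Suc by metis
  qed
  have om: "Ord (m n)" for n using m\<alpha> o Ord_mem by blast
  define \<xi> where "\<xi> = set_of (\<Union>n. elts (m n))"
  have sub: "(\<Union>n. elts (m n)) \<subseteq> elts \<alpha>" using m\<alpha> Ord_trans o by blast
  then have \<xi>: "elts \<xi> = (\<Union>n. elts (m n))"
    unfolding \<xi>_def by (intro elts_set_of small_subset[OF small_elts])
  have o\<xi>: "Ord \<xi>" by (rule Ord_Union[of _ "range m"]) (use \<xi> om in auto)
  have "\<xi> = \<alpha> \<or> \<xi> \<in> elts \<alpha>" using Ord_subset_iff[OF o\<xi> o(1)] sub \<xi> by blast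
  then have \<xi>\<beta>: "\<xi> \<in> elts \<beta>" using \<beta> \<alpha>\<beta> by blast
  have "is_ladder \<xi> m" using m_step by (auto simp: is_ladder_def \<xi>)
  then have L: "is_ladder \<xi> (ladder \<xi>)" by (rule is_ladder_ladder)
  have h_mem: "h x \<in> elts \<xi>" if x: "x \<in> elts \<xi>" for x
  proof -
    obtain n where n: "x \<in> elts (m n)" using x \<xi> by auto
    have "x \<in> elts \<beta>" using x \<xi>\<beta> \<beta> Ord_trans by blast
    then have "h x \<in> elts (m (Suc n))" using mono[OF _ \<alpha>\<beta>[OF m\<alpha>] n] by (simp add: m_def)
    then show ?thesis using \<xi> by auto
  qed
  have hL: "is_ladder (h \<xi>) (ladder (h \<xi>))" "\<And>n. h (ladder \<xi> n) = ladder (h \<xi>) n"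
    using lad[OF \<xi>\<beta> L] by blast+
  \<comment> \<open>The rungs of \<open>h \<xi>\<close> are the images of the rungs of
    \<open>\<xi>\<close>, and \<open>h\<close> maps \<open>\<xi>\<close> into itself.\<close>
  have "elts (h \<xi>) \<subseteq> elts \<xi>"
  proof
    fix y assume "y \<in> elts (h \<xi>)"
    then obtain n where "y \<in> elts (ladder (h \<xi>) n)"
      using hL(1) unfolding is_ladder_def by blast
    moreover have "ladder (h \<xi>) n \<in> elts \<xi>"
      using hL(2)[of n] h_mem[of "ladder \<xi> n"] L unfolding is_ladder_def by simp
    ultimately show "y \<in> elts \<xi>" using o\<xi> Ord_trans by blast
  qed
  moreover have oh: "Ord (h \<xi>)" using h[OF \<xi>\<beta>] \<beta> Ord_mem by blast
  ultimately have "h \<xi> = \<xi> \<or> h \<xi> \<in> elts \<xi>" using Ord_subset_iff[OF oh o\<xi>] by blast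
  moreover have "h \<xi> \<notin> elts \<xi>"
  proof
    assume "h \<xi> \<in> elts \<xi>"
    \<comment> \<open>If some ordinal is moved down, take the least such \<open>y\<close>; then
      \<open>h y\<close> is moved down as well and is smaller.\<close>
    then obtain y where y: "h y \<in> elts y \<and> y \<in> elts \<beta>"
      and least: "\<And>z. z \<in> elts y \<Longrightarrow> \<not> (h z \<in> elts z \<and> z \<in> elts \<beta>)"
      using Ord_least[of "\<lambda>x. h x \<in> elts x \<and> x \<in> elts \<beta>" \<xi>] \<xi>\<beta> Ord_mem[OF \<beta>(1)] by metis
    moreover have "h y \<in> elts \<beta>" using y Ord_trans[OF \<beta>(1)] by blast
    ultimately show False using mono[of "h y" y] least[of "h y"] by blast
  qed
  ultimately have "h \<xi> = \<xi>" by blast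
  then have fixl: "h (ladder \<xi> n) = ladder \<xi> n" for n using hL(2) by simp
  have "\<mu> \<in> elts (m (Suc 0))" using \<mu> by (simp add: m_def)
  then have "\<mu> \<in> elts \<xi>" using \<xi> by blast
  then obtain k where k: "\<mu> \<in> elts (ladder \<xi> k)" "ladder \<xi> k \<in> elts \<xi>"
    using L by (auto simp: is_ladder_def)
  define x where "x = ladder \<xi> k"
  have x\<beta>: "x \<in> elts \<beta>" using k \<xi>\<beta> \<beta> Ord_trans by (auto simp: x_def)
  then have ox: "Ord x" using \<beta> Ord_mem by blast
  \<comment> \<open>The rung \<open>x\<close> is fixed and lies above \<open>\<mu>\<close>, so
    repeated application of \<open>h\<close> keeps the whole critical sequence below
    \<open>x\<close>. Hence \<open>x\<close> cannot be smaller than the supremum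
    \<open>\<xi>\<close>.\<close>
  have "m n \<in> elts x" for n
  proof (induction n)
    case 0 then show ?case using k by (simp add: m_def x_def)
  next
    case (Suc n)
    then show ?case using mono[OF \<alpha>\<beta>[OF m\<alpha>] x\<beta>] fixl[of k] by (simp add: m_def x_def)
  qed
  then have "elts \<xi> \<subseteq> elts x" using ox Ord_trans by (auto simp: \<xi>)
  then show False using k by (auto simp: x_def)
qed

text \<open>The hypotheses on \<open>h\<close> are what preservation of the relations coded later
  will supply. The assumption \<open>top\<close> is separate from \<open>list\<close> because
  \<open>\<beta>\<close> and \<open>\<gamma>\<close> are not elements of their own domains.\<close>

lemma no_preserving_map:
  assumes \<beta>: "Ord \<delta>" "\<alpha> \<in> elts \<beta>" "\<beta> \<in> elts \<gamma>" "\<gamma> \<in> elts \<delta>"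
    and G: "incoherent G \<alpha> \<delta>"
    and h: "\<And>x. x \<in> elts \<beta> \<Longrightarrow> h x \<in> elts \<gamma>"
    and mono: "\<And>x y. x \<in> elts \<beta> \<Longrightarrow> y \<in> elts \<beta> \<Longrightarrow> x \<in> elts y \<Longrightarrow> h x \<in> elts (h y)"
    and fixed: "h \<alpha> = \<alpha>"
    and lad: "\<And>\<xi> n. \<xi> \<in> elts \<beta> \<Longrightarrow> is_ladder \<xi> (ladder \<xi>) \<Longrightarrow>
        is_ladder (h \<xi>) (ladder (h \<xi>)) \<and> h (ladder \<xi> n) = ladder (h \<xi>) n"
    and list: "\<And>x y n. x \<in> elts \<beta> \<Longrightarrow> y \<in> elts \<beta> \<Longrightarrow> x \<in> G y n \<longleftrightarrow> h x \<in> G (h y) n"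
    and top: "\<And>x n. x \<in> elts \<beta> \<Longrightarrow> x \<in> G \<beta> n \<longleftrightarrow> h x \<in> G \<gamma> n"
  shows False
proof -
  have o: "Ord \<gamma>" "Ord \<beta>" using \<beta> Ord_mem by blast+
  have \<gamma>\<delta>: "x \<in> elts \<delta>" if "x \<in> elts \<gamma>" for x using that \<beta> Ord_trans by blast
  show False
  proof (cases "\<exists>x\<in>elts \<beta>. h x \<noteq> x")
    case False
    have "coherent G \<beta> \<gamma>"
      unfolding coherent_def
    proof (intro allI set_eqI)
      fix n x
      show "x \<in> G \<beta> n \<inter> elts \<beta> \<longleftrightarrow> x \<in> G \<gamma> n \<inter> elts \<beta>"
        using False top[of x n] by auto
    qed
    then show False using incoherentD[OF G] \<beta> by blast
  next
    case True
    then obtain x where "x \<in> elts \<beta> \<and> h x \<noteq> x" by blast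
    \<comment> \<open>The least moved ordinal is the critical point; it is moved upwards, since
      \<open>h\<close> is the identity below it.\<close>
    then obtain \<mu> where \<mu>': "\<mu> \<in> elts \<beta> \<and> h \<mu> \<noteq> \<mu>"
      and "\<And>y. y \<in> elts \<mu> \<Longrightarrow> \<not> (y \<in> elts \<beta> \<and> h y \<noteq> y)"
      using Ord_least[of "\<lambda>x. x \<in> elts \<beta> \<and> h x \<noteq> x" x] Ord_mem[OF o(2)] by metis
    then have least: "h y = y" if "y \<in> elts \<mu>" for y using that Ord_trans[OF o(2)] by blast
    note \<mu> = conjunct1[OF \<mu>'] conjunct2[OF \<mu>']
    have oh: "Ord (h \<mu>)" "Ord \<mu>" using h \<mu> o Ord_mem by blast+
    have "elts \<mu> \<subseteq> elts (h \<mu>)" 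
    proof
      fix y assume y: "y \<in> elts \<mu>"
      then have "y \<in> elts \<beta>" using \<mu>(1) Ord_trans[OF o(2)] by blast
      then show "y \<in> elts (h \<mu>)" using mono[OF _ \<mu>(1) y] least[OF y] by simp
    qed
    then have \<mu>h: "\<mu> \<in> elts (h \<mu>)" using Ord_subset_iff[OF oh(2,1)] \<mu> by auto
    have "coherent G \<mu> (h \<mu>)"
      unfolding coherent_def
    proof (intro allI set_eqI)
      fix n x
      show "x \<in> G \<mu> n \<inter> elts \<mu> \<longleftrightarrow> x \<in> G (h \<mu>) n \<inter> elts \<mu>"
        using list[OF _ \<mu>(1), of x n] least[of x] Ord_trans[OF o(2) _ \<mu>(1), of x] by auto
    qed
    moreover have "\<alpha> \<in> elts \<mu>"
      by (rule critical_point_above[OF o(2,1) \<beta>(2) h mono fixed lad \<mu>(1) \<mu>h])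
    ultimately show False using incoherentD[OF G _ \<mu>h \<gamma>\<delta>[OF h[OF \<mu>(1)]]] by blast
  qed
qed

section \<open>Structures on ordinals with binary relations\<close>

text \<open>Predicates and constants will be coded as binary relations too, so that a single shape
  of atomic formula expresses everything to be preserved. The map \<open>nm\<close> names the
  symbols by sets of the universe.\<close>

definition binary_signature :: "('i \<Rightarrow> 'a) \<Rightarrow> 'a signature" where
  "binary_signature nm =
     \<lparr>fun_syms = {}, fun_arity = \<lambda>_. 0, rel_syms = range nm, rel_arity = \<lambda>_. 2\<rparr>"

definition binary_rel :: "('a::zermelo \<times> 'a) set \<Rightarrow> 'a" where
  "binary_rel X = set_of ((\<lambda>(x, y). tuple [x, y]) ` X)"

definition graph :: "('i \<Rightarrow> 'a::zermelo) \<Rightarrow> ('i \<Rightarrow> 'a) \<Rightarrow> 'a" where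
  "graph nm g = set_of (range (\<lambda>i. opair (nm i) (g i)))"

definition binary_structure ::
  "('i \<Rightarrow> 'a::zermelo) \<Rightarrow> 'a \<Rightarrow> ('i \<Rightarrow> ('a \<times> 'a) set) \<Rightarrow> 'a" where
  "binary_structure nm D S =
     opair D (opair (set_of {}) (graph nm (\<lambda>i. binary_rel (S i))))"

section \<open>Ranks of coded structures\<close>

lemma Ord_succ_power: "Ord \<zeta> \<Longrightarrow> Ord ((succ ^^ n) \<zeta>)"
  by (induction n) (auto intro: Ord_succ)

lemma V_succ_power_mono:
  assumes "Ord \<zeta>" "m \<le> n" shows "V ((succ ^^ m) \<zeta>) \<subseteq> V ((succ ^^ n) \<zeta>)"
  using assms(2)
proof (induction n rule: dec_induct)
  case (step n)
  have "V ((succ ^^ n) \<zeta>) \<subseteq> V ((succ ^^ Suc n) \<zeta>)" by (rule V_mono) auto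
  then show ?case using step by blast
qed simp

lemma opair_in_V_power:
  assumes "Ord \<zeta>" "x \<in> V ((succ ^^ m) \<zeta>)" "y \<in> V ((succ ^^ n) \<zeta>)" "m \<le> k" "n \<le> k"
  shows "opair x y \<in> V ((succ ^^ (k + 2)) \<zeta>)"
  using opair_in_V[OF Ord_succ_power[OF assms(1)], of x k y] V_succ_power_mono[OF assms(1)] assms
  by (auto simp: subset_iff)

text \<open>A bound in the hierarchy does the work of replacement: any part of a level is
  small.\<close>

lemma set_of_in_V_power:
  assumes "Ord (\<zeta> :: 'a::cumulative)" "X \<subseteq> V ((succ ^^ n) \<zeta>)"
  shows "small X" "set_of X \<in> V ((succ ^^ (n + 1)) \<zeta>)"
proof -
  show "small X" by (rule small_subset[OF small_V assms(2)]) (rule Ord_succ_power[OF assms(1)])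
  then show "set_of X \<in> V ((succ ^^ (n + 1)) \<zeta>)"
    using assms by (simp add: V_succ Ord_succ_power)
qed

text \<open>Levels are counted above \<open>\<zeta>\<close>: a pair costs two, collecting objects
  into a set costs one. Tuples arrive at 5, relations at 6, their graph at 9, the structure at 14.
  Only finiteness of this number matters for a limit \<open>\<delta>\<close>.\<close>

lemma binary_structure_in_V:
  fixes nm :: "'i \<Rightarrow> 'a::cumulative"
  assumes \<zeta>: "Ord \<zeta>" "elts D \<subseteq> V \<zeta>" "range nm \<subseteq> V \<zeta>"
    and S: "\<And>i. S i \<subseteq> elts D \<times> elts D"
  shows "small ((\<lambda>(x, y). tuple [x, y]) ` S i)"
    and "small (range (\<lambda>i. opair (nm i) (binary_rel (S i))))"
    and "binary_structure nm D S \<in> V ((succ ^^ 14) \<zeta>)"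
proof -
  have D: "set_of (elts D) \<in> V ((succ ^^ (0 + 1)) \<zeta>)"
    by (rule set_of_in_V_power[OF \<zeta>(1)]) (use \<zeta> in simp)
  have e: "set_of {} \<in> V ((succ ^^ (0 + 1)) \<zeta>)"
    by (rule set_of_in_V_power[OF \<zeta>(1)]) simp
  have el: "x \<in> V ((succ ^^ 0) \<zeta>)" if "x \<in> elts D" for x using that \<zeta> by auto
  have "tuple [x, y] \<in> V ((succ ^^ (3 + 2)) \<zeta>)" if "x \<in> elts D" "y \<in> elts D" for x y
  proof -
    have "opair y (set_of {}) \<in> V ((succ ^^ (1 + 2)) \<zeta>)"
      by (rule opair_in_V_power[OF \<zeta>(1) el e]) (use that in auto)
    from opair_in_V_power[OF \<zeta>(1) el[OF that(1)] this, of 3]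
    show ?thesis unfolding tuple.simps by simp
  qed
  then have sub: "(\<lambda>(x, y). tuple [x, y]) ` S i \<subseteq> V ((succ ^^ 5) \<zeta>)" for i
    using S[of i] by fastforce
  from set_of_in_V_power(1)[OF \<zeta>(1) sub] show "small ((\<lambda>(x, y). tuple [x, y]) ` S i)" .
  have r: "binary_rel (S i) \<in> V ((succ ^^ 6) \<zeta>)" for i
    using set_of_in_V_power(2)[OF \<zeta>(1) sub, of i] by (simp add: binary_rel_def)
  have "opair (nm i) (binary_rel (S i)) \<in> V ((succ ^^ (6 + 2)) \<zeta>)" for i
    by (rule opair_in_V_power[OF \<zeta>(1) _ r, of _ 0]) (use \<zeta> in auto)
  then have sub2: "range (\<lambda>i. opair (nm i) (binary_rel (S i))) \<subseteq> V ((succ ^^ 8) \<zeta>)" by auto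
  from set_of_in_V_power(1)[OF \<zeta>(1) sub2]
  show "small (range (\<lambda>i. opair (nm i) (binary_rel (S i))))" .
  have g: "graph nm (\<lambda>i. binary_rel (S i)) \<in> V ((succ ^^ (8 + 1)) \<zeta>)"
    unfolding graph_def by (rule set_of_in_V_power(2)[OF \<zeta>(1) sub2])
  have "opair (set_of {}) (graph nm (\<lambda>i. binary_rel (S i))) \<in> V ((succ ^^ (10 + 2)) \<zeta>)"
    by (rule opair_in_V_power[OF \<zeta>(1) e g]) auto
  then have "opair D (opair (set_of {}) (graph nm (\<lambda>i. binary_rel (S i)))) \<in> V ((succ ^^ (12 + 2)) \<zeta>)"
    using D by (intro opair_in_V_power[OF \<zeta>(1), of D 1 _ 12]) simp_all
  then show "binary_structure nm D S \<in> V ((succ ^^ 14) \<zeta>)" by (simp add: binary_structure_def)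
qed

lemma domain_opair [simp]: "domain (opair D I) = elts D"
proof -
  have "(THE D'. \<exists>J. opair D I = opair D' J) = D" by (rule the_equality) auto
  then show ?thesis by (simp add: domain_def)
qed

lemma rels_opair [simp]: "rels (opair D (opair F R)) = R"
  unfolding rels_def by (rule the_equality) auto

lemma graph_function:
  assumes "inj nm" "small (range (\<lambda>i. opair (nm i) (g i)))"
  shows "function_on (graph nm g) (range nm)" and "app (graph nm g) (nm i) = g i"
proof -
  have mem: "opair (nm j) y \<in> elts (graph nm g) \<longleftrightarrow> y = g j" for j y
    using assms(2) inj_eq[OF assms(1)] by (auto simp: graph_def)
  show "function_on (graph nm g) (range nm)"
    unfolding function_on_def by (auto simp: mem) (auto simp: graph_def assms(2))
  show "app (graph nm g) (nm i) = g i"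
    unfolding app_def by (simp add: mem)
qed

lemma binary_structure:
  fixes nm :: "'i \<Rightarrow> 'a::cumulative"
  assumes \<zeta>: "Ord \<zeta>" "elts D \<subseteq> V \<zeta>" "range nm \<subseteq> V \<zeta>"
    and S: "\<And>i. S i \<subseteq> elts D \<times> elts D" and "inj nm" "elts D \<noteq> {}"
  shows "is_structure (binary_signature nm) (binary_structure nm D S)"
    and "domain (binary_structure nm D S) = elts D"
    and "sat (binary_structure nm D S) s (Rel (nm i) [Var 0, Var 1]) \<longleftrightarrow> (s 0, s 1) \<in> S i"
proof -
  note small = binary_structure_in_V(1,2)[where S = S, OF \<zeta> S]
  note gr = graph_function[OF \<open>inj nm\<close> small(2)]
  have rel: "elts (binary_rel (S i)) = (\<lambda>(x, y). tuple [x, y]) ` S i" for i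
    using small(1) by (simp add: binary_rel_def)
  have "t \<in> tuples (elts D) 2" if "t \<in> elts (binary_rel (S i))" for t i
  proof -
    from that obtain x y where "t = tuple [x, y]" "(x, y) \<in> S i" unfolding rel by auto
    then show "t \<in> tuples (elts D) 2"
      using S[of i] unfolding tuples_def by (intro CollectI exI[of _ "[x, y]"]) auto
  qed
  moreover have "function_on (set_of {}) {}" by (simp add: function_on_def)
  ultimately show "is_structure (binary_signature nm) (binary_structure nm D S)"
    unfolding is_structure_def binary_structure_def binary_signature_def
    using gr assms(6) by (intro exI conjI) auto
  show "domain (binary_structure nm D S) = elts D"
    by (simp add: binary_structure_def)
  show "sat (binary_structure nm D S) s (Rel (nm i) [Var 0, Var 1]) \<longleftrightarrow> (s 0, s 1) \<in> S i"
    by (auto simp: binary_structure_def gr(2) rel)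
qed

lemma embedding_preserves:
  fixes nm :: "'i \<Rightarrow> 'a::cumulative"
  assumes "elementary_embedding (binary_signature nm) h A B"
    and A: "domain A = elts D" "\<And>s i. sat A s (Rel (nm i) [Var 0, Var 1]) \<longleftrightarrow> (s 0, s 1) \<in> S i"
    and B: "\<And>s i. sat B s (Rel (nm i) [Var 0, Var 1]) \<longleftrightarrow> (s 0, s 1) \<in> T i"
    and x: "x \<in> elts D" "y \<in> elts D"
  shows "(x, y) \<in> S i \<longleftrightarrow> (h x, h y) \<in> T i"
proof -
  \<comment> \<open>All variables other than 0 receive \<open>y\<close>, which keeps the range of
    \<open>s\<close> inside the domain.\<close>
  define s where "s = (\<lambda>k::nat. if k = 0 then x else y)"
  have "range s \<subseteq> domain A" using x A by (auto simp: s_def)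
  moreover have "fm_over (binary_signature nm) (Rel (nm i) [Var 0, Var 1])"
    by (simp add: binary_signature_def)
  ultimately have "sat A s (Rel (nm i) [Var 0, Var 1]) \<longleftrightarrow> sat B (h \<circ> s) (Rel (nm i) [Var 0, Var 1])"
    using assms(1) unfolding elementary_embedding_def by blast
  then show ?thesis unfolding A B by (simp add: s_def)
qed

section \<open>Structures carrying an incoherent list\<close>

datatype symbol = Less | Base | Rung nat | List nat | Top nat

instance symbol :: countable by countable_datatype

text \<open>\<open>Base\<close> pins down the point \<open>\<alpha>\<close>. \<open>Rung\<close> is
  empty at points without a ladder, so preserving it also preserves the existence of one.
  \<open>Top\<close> records the entry at \<open>\<eta>\<close> itself, as a relation that ignores
  its second argument.\<close>

definition ordinal_relations :: "('a::zermelo \<Rightarrow> nat \<Rightarrow> 'a set) \<Rightarrow> 'a \<Rightarrow> 'a \<Rightarrow> symbol \<Rightarrow> ('a \<times> 'a) set" where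
  "ordinal_relations G \<alpha> \<eta> i = (elts \<eta> \<times> elts \<eta>) \<inter> (case i of
       Less \<Rightarrow> {(x, y). x \<in> elts y}
     | Base \<Rightarrow> {(\<alpha>, \<alpha>)}
     | Rung n \<Rightarrow> {(x, y). is_ladder y (ladder y) \<and> x = ladder y n}
     | List n \<Rightarrow> {(x, y). x \<in> G y n}
     | Top n \<Rightarrow> {(x, y). x \<in> G \<eta> n})"

text \<open>Finite cardinality embeds such an ordinal into the natural numbers. Contrapositively, an
  uncountable ordinal has an infinite member, which will supply names for countably many
  symbols.\<close>

lemma countable_initial_segments:
  assumes "Ord (\<delta> :: 'a::zermelo)" "\<And>\<alpha>. \<alpha> \<in> elts \<delta> \<Longrightarrow> finite (elts \<alpha>)"
  shows "countable (elts \<delta>)"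
proof -
  have less: "card (elts x) < card (elts y)" if "y \<in> elts \<delta>" "x \<in> elts y" for x y
  proof (rule psubset_card_mono)
    show "finite (elts y)" using assms(2) that by blast
    have "elts x \<subseteq> elts y" using that assms(1) Ord_mem Ord_transD by blast
    moreover have "elts x \<noteq> elts y" using that mem_not_refl[of x] by metis
    ultimately show "elts x \<subset> elts y" by blast
  qed
  have "inj_on (\<lambda>x. card (elts x)) (elts \<delta>)"
  proof (rule inj_onI)
    fix x y assume *: "x \<in> elts \<delta>" "y \<in> elts \<delta>" "card (elts x) = card (elts y)"
    then have "Ord x" "Ord y" using assms Ord_mem by auto
    then show "x = y" using less[of x y] less[of y x] * Ord_linear[of x y] by auto
  qed
  then show ?thesis by (rule countableI)
qed

text \<open>The class consists of structures \<open>M \<eta>\<close> with domain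
  \<open>\<eta>\<close>, for \<open>\<eta>\<close> between \<open>\<alpha>\<close> and
  \<open>\<delta>\<close>. Members smaller than a cardinal \<open>\<kappa>\<close> have index below
  \<open>\<kappa>\<close>, and incoherence prevents them from embedding into
  \<open>M \<kappa>\<close>.\<close>

lemma not_subtle_imp_not_WSR:
  fixes \<delta> :: "'a::cumulative"
  assumes \<delta>: "Card \<delta>" "uncountable (elts \<delta>)"
    and not: "\<not> subtle \<delta>" "\<not> limit_of_subtle \<delta>"
  shows "\<exists>\<sigma> \<C>. countable_signature \<sigma> \<and> (\<forall>M\<in>elts \<C>. is_structure \<sigma> M) \<and>
      \<C> \<in> V (succ \<delta>) - V \<delta> \<and> (\<forall>\<kappa>\<in>elts \<delta>. Card \<kappa> \<longrightarrow> \<not> WSR \<sigma> \<C> \<kappa>)"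
proof -
  have o\<delta>: "Ord \<delta>" by (rule CardD[OF \<delta>(1)])
  have inf: "infinite (elts \<delta>)" using \<delta>(2) countable_finite by blast
  note lim = infinite_Card_limit[OF \<delta>(1) inf]
  obtain \<alpha> where \<alpha>: "\<alpha> \<in> elts \<delta>" "\<And>\<kappa>. \<kappa> \<in> elts \<delta> \<Longrightarrow> \<alpha> \<in> elts \<kappa> \<Longrightarrow> \<not> subtle \<kappa>"
    using not(2) by (auto simp: limit_of_subtle_def)
  obtain G where G: "incoherent G \<alpha> \<delta>"
    using incoherent_exists[OF o\<delta>, of \<alpha>] not(1) \<alpha>(2) by blast
  obtain w where w: "w \<in> elts \<delta>" "infinite (elts w)"
    using countable_initial_segments[OF o\<delta>] \<delta>(2) by blast
  then obtain e :: "nat \<Rightarrow> 'a" where e: "inj e" "range e \<subseteq> elts w"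
    using infinite_countable_subset by blast
  define nm :: "symbol \<Rightarrow> 'a" where "nm = e \<circ> to_nat"
  have nm: "inj nm" "range nm \<subseteq> elts w"
    using e by (auto simp: nm_def intro: inj_compose)
  define S where "S = ordinal_relations G \<alpha>"
  define M where "M \<eta> = binary_structure nm \<eta> (S \<eta>)" for \<eta>
  have S: "S \<eta> i \<subseteq> elts \<eta> \<times> elts \<eta>" for \<eta> i by (auto simp: S_def ordinal_relations_def)
  \<comment> \<open>The larger of \<open>\<eta>\<close> and \<open>w\<close> bounds the ranks of
    both the domain and the names.\<close>
  have up: "\<exists>\<zeta>\<in>elts \<delta>. Ord \<zeta> \<and> elts \<eta> \<subseteq> V \<zeta> \<and> range nm \<subseteq> V \<zeta>" if "\<eta> \<in> elts \<delta>" for \<eta>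
  proof -
    have o: "Ord \<eta>" "Ord w" using that w o\<delta> Ord_mem by blast+
    have "elts w \<subseteq> elts \<eta> \<or> elts \<eta> \<subseteq> elts w"
      using Ord_linear[OF o] Ord_transD o by blast
    then show ?thesis
    proof
      assume "elts w \<subseteq> elts \<eta>"
      then show ?thesis using Ord_subset_V[OF o(1)] nm that o by (intro bexI[of _ \<eta>]) auto
    next
      assume "elts \<eta> \<subseteq> elts w"
      then show ?thesis using Ord_subset_V[OF o(2)] nm w o by (intro bexI[of _ w]) auto
    qed
  qed
  have M_V: "M \<eta> \<in> V \<delta>" if \<eta>: "\<eta> \<in> elts \<delta>" for \<eta>
  proof -
    obtain \<zeta> where \<zeta>: "\<zeta> \<in> elts \<delta>" "Ord \<zeta>" "elts \<eta> \<subseteq> V \<zeta>" "range nm \<subseteq> V \<zeta>"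
      using up[OF \<eta>] by blast
    have "(succ ^^ n) \<zeta> \<in> elts \<delta>" for n by (induction n) (use \<zeta> lim in auto)
    then have "V ((succ ^^ 14) \<zeta>) \<subseteq> V \<delta>" by (rule V_mono_mem[OF o\<delta>])
    then show ?thesis unfolding M_def using binary_structure_in_V(3)[where S = "S \<eta>", OF \<zeta>(2-4) S] by blast
  qed
  have struct: "is_structure (binary_signature nm) (M \<eta>)" "domain (M \<eta>) = elts \<eta>"
      "sat (M \<eta>) s (Rel (nm i) [Var 0, Var 1]) \<longleftrightarrow> (s 0, s 1) \<in> S \<eta> i"
    if \<eta>: "\<eta> \<in> elts \<delta>" "\<alpha> \<in> elts \<eta>" for \<eta> s i
  proof -
    obtain \<zeta> where \<zeta>: "Ord \<zeta>" "elts \<eta> \<subseteq> V \<zeta>" "range nm \<subseteq> V \<zeta>"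
      using up[OF \<eta>(1)] by blast
    have ne: "elts \<eta> \<noteq> {}" using \<eta> by blast
    note * = binary_structure[where S = "S \<eta>", OF \<zeta> S nm(1) ne, folded M_def]
    show "is_structure (binary_signature nm) (M \<eta>)" by (rule *(1))
    show "domain (M \<eta>) = elts \<eta>" by (rule *(2))
    show "sat (M \<eta>) s (Rel (nm i) [Var 0, Var 1]) \<longleftrightarrow> (s 0, s 1) \<in> S \<eta> i" by (rule *(3))
  qed
  have no: "\<not> elementary_embedding (binary_signature nm) h (M \<beta>) (M \<gamma>)"
    if b: "\<alpha> \<in> elts \<beta>" "\<beta> \<in> elts \<gamma>" "\<gamma> \<in> elts \<delta>" for h \<beta> \<gamma>
  proof
    assume emb: "elementary_embedding (binary_signature nm) h (M \<beta>) (M \<gamma>)"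
    have o: "Ord \<gamma>" "Ord \<beta>" using b o\<delta> Ord_mem by blast+
    have \<beta>\<delta>: "\<beta> \<in> elts \<delta>" using b o\<delta> Ord_trans by blast
    have \<alpha>\<gamma>: "\<alpha> \<in> elts \<gamma>" using b o Ord_trans by blast
    have pres: "(x, y) \<in> S \<beta> i \<longleftrightarrow> (h x, h y) \<in> S \<gamma> i" if "x \<in> elts \<beta>" "y \<in> elts \<beta>" for x y i
      by (rule embedding_preserves[OF emb struct(2)[OF \<beta>\<delta> b(1)] struct(3)[OF \<beta>\<delta> b(1)]
            struct(3)[OF b(3) \<alpha>\<gamma>] that])
    have h: "h x \<in> elts \<gamma>" if "x \<in> elts \<beta>" for x
      using emb that struct(2)[OF \<beta>\<delta> b(1)] struct(2)[OF b(3) \<alpha>\<gamma>]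
      by (auto simp: elementary_embedding_def)
    note defs = S_def ordinal_relations_def
    show False
    proof (rule no_preserving_map[OF o\<delta> b G h])
      show "h x \<in> elts (h y)" if "x \<in> elts \<beta>" "y \<in> elts \<beta>" "x \<in> elts y" for x y
        using pres[of x y Less] that h by (auto simp: defs)
      show "h \<alpha> = \<alpha>" using pres[of \<alpha> \<alpha> Base] b by (auto simp: defs)
      show "is_ladder (h \<xi>) (ladder (h \<xi>)) \<and> h (ladder \<xi> n) = ladder (h \<xi>) n"
        if "\<xi> \<in> elts \<beta>" "is_ladder \<xi> (ladder \<xi>)" for \<xi> n
      proof -
        have "ladder \<xi> n \<in> elts \<beta>" using that o Ord_trans unfolding is_ladder_def by blast
        then show ?thesis using pres[of "ladder \<xi> n" \<xi> "Rung n"] that h by (auto simp: defs)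
      qed
      show "x \<in> G y n \<longleftrightarrow> h x \<in> G (h y) n" if "x \<in> elts \<beta>" "y \<in> elts \<beta>" for x y n
        using pres[of x y "List n"] that h by (auto simp: defs)
      show "x \<in> G \<beta> n \<longleftrightarrow> h x \<in> G \<gamma> n" if "x \<in> elts \<beta>" for x n
        using pres[of x x "Top n"] that h by (auto simp: defs)
    qed
  qed
  define X where "X = M ` {\<eta> \<in> elts \<delta>. \<alpha> \<in> elts \<eta>}"
  have XV: "X \<subseteq> V \<delta>" using M_V by (auto simp: X_def)
  then have elts_C: "elts (set_of X) = X"
    using small_subset[OF small_V[OF o\<delta>]] by simp
  have "set_of X \<notin> V \<delta>"
  proof
    assume "set_of X \<in> V \<delta>"
    then obtain \<eta> where \<eta>: "\<eta> \<in> elts \<delta>" "X \<subseteq> V \<eta>" using elts_C mem_V by metis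
    \<comment> \<open>The successor of the larger of \<open>\<eta>\<close> and
      \<open>\<alpha>\<close>: its structure belongs to the class but has a domain of too large a
      rank for \<open>V \<eta>\<close>.\<close>
    define \<zeta> where "\<zeta> = (if \<alpha> \<in> elts \<eta> then succ \<eta> else succ \<alpha>)"
    have o: "Ord \<eta>" "Ord \<alpha>" using \<eta> \<alpha> o\<delta> Ord_mem by blast+
    have \<zeta>: "\<zeta> \<in> elts \<delta>" "\<alpha> \<in> elts \<zeta>" "\<eta> \<in> elts \<zeta>"
      using \<eta> \<alpha> lim Ord_linear[OF o] by (auto simp: \<zeta>_def)
    then have "M \<zeta> \<in> V \<eta>" using \<eta> by (auto simp: X_def)
    then obtain I where "opair \<zeta> I \<in> V \<eta>" by (auto simp: M_def binary_structure_def)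
    then have "\<zeta> \<in> V \<eta>" by (rule fst_in_V[OF o(1)])
    then have "\<eta> \<in> V \<eta>" using \<zeta>(3) V_transitive[OF o(1)] by blast
    then show False using Ord_not_in_V[OF o(1)] by blast
  qed
  moreover have "set_of X \<in> V (succ \<delta>)" using XV elts_C by (simp add: V_succ[OF o\<delta>])
  moreover have "\<not> WSR (binary_signature nm) (set_of X) \<kappa>" if \<kappa>: "\<kappa> \<in> elts \<delta>" "Card \<kappa>" for \<kappa>
  proof
    assume WSR: "WSR (binary_signature nm) (set_of X) \<kappa>"
    have small_index: "\<exists>\<beta>\<in>elts \<kappa>. \<alpha> \<in> elts \<beta> \<and> A = M \<beta>"
      if A: "A \<in> X" "domain A \<prec> elts \<kappa>" for A
    proof -
      obtain \<beta> where \<beta>: "\<beta> \<in> elts \<delta>" "\<alpha> \<in> elts \<beta>" "A = M \<beta>" using A by (auto simp: X_def)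
      then have "elts \<beta> \<prec> elts \<kappa>" using A struct(2) by simp
      then show ?thesis using Card_lesspoll_iff[OF \<kappa>(2)] \<beta> o\<delta> Ord_mem by blast
    qed
    \<comment> \<open>The first clause of \<open>WSR\<close> places \<open>\<alpha>\<close> below
      \<open>\<kappa>\<close>, so that \<open>M \<kappa>\<close> is a member of the class.\<close>
    obtain A where "A \<in> X" "domain A \<prec> elts \<kappa>" using WSR elts_C by (auto simp: WSR_def)
    then have \<alpha>\<kappa>: "\<alpha> \<in> elts \<kappa>" using small_index CardD[OF \<kappa>(2)] Ord_trans by blast
    then have "M \<kappa> \<in> X" "domain (M \<kappa>) \<approx> elts \<kappa>" using \<kappa> struct(2) by (auto simp: X_def)
    then obtain A h where "A \<in> X" "domain A \<prec> elts \<kappa>"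
      "elementary_embedding (binary_signature nm) h A (M \<kappa>)"
      using WSR elts_C unfolding WSR_def by metis
    then show False using small_index no \<kappa> by blast
  qed
  moreover have "countable_signature (binary_signature nm)"
    by (auto simp: countable_signature_def binary_signature_def)
  moreover have "\<forall>M\<in>elts (set_of X). is_structure (binary_signature nm) M"
    using struct(1) elts_C by (auto simp: X_def)
  ultimately show ?thesis by blast
qed

section \<open>Counting formulas and lists\<close>

lemma lepoll_total: "A \<lesssim> B \<or> B \<lesssim> A"
  using ordLeq_total[OF card_of_Well_order card_of_Well_order, of A B]
  by (simp add: lepoll_def card_of_ordLeq[symmetric])

lemma infinite_times_lepoll: "infinite A \<Longrightarrow> A \<times> A \<lesssim> A"
  unfolding lepoll_def card_of_ordLeq by (rule ordIso_imp_ordLeq[OF card_of_Times_same_infinite])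

text \<open>Folding a pairing function over a list determines the list once its length is known; the
  length, coded through \<open>e\<close>, is therefore paired in.\<close>

lemma lists_lepoll:
  assumes "infinite A" shows "lists A \<lesssim> A"
proof -
  obtain p where p: "inj_on p (A \<times> A)" "p ` (A \<times> A) \<subseteq> A"
    using infinite_times_lepoll[OF assms] by (auto simp: lepoll_def)
  have pA: "p (x, y) \<in> A" if "x \<in> A" "y \<in> A" for x y using p(2) that by blast
  obtain e :: "nat \<Rightarrow> 'a" where e: "inj e" "range e \<subseteq> A"
    using assms infinite_countable_subset by blast
  define c where "c xs = foldr (\<lambda>x y. p (x, y)) xs (e 0)" for xs
  have c: "c [] = e 0" "c (x # xs) = p (x, c xs)" for x xs by (simp_all add: c_def)
  have cA: "c xs \<in> A" if "xs \<in> lists A" for xs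
    using that by (induction xs) (use pA e in \<open>auto simp: c\<close>)
  have inj: "xs = ys"
    if "xs \<in> lists A" "ys \<in> lists A" "length xs = length ys" "c xs = c ys" for xs ys
    using that(3,1,2,4)
  proof (induction xs ys rule: list_induct2)
    case (Cons x xs y ys)
    then have "(x, c xs) = (y, c ys)" using cA by (intro inj_onD[OF p(1)]) (auto simp: c)
    then show ?case using Cons by auto
  qed auto
  have "inj_on (\<lambda>xs. p (e (length xs), c xs)) (lists A)"
  proof (rule inj_onI)
    fix xs ys assume *: "xs \<in> lists A" "ys \<in> lists A" "p (e (length xs), c xs) = p (e (length ys), c ys)"
    then have "(e (length xs), c xs) = (e (length ys), c ys)"
      using cA e by (intro inj_onD[OF p(1)]) auto
    then show "xs = ys" using inj * e(1) by (auto dest: injD)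
  qed
  moreover have "(\<lambda>xs. p (e (length xs), c xs)) ` lists A \<subseteq> A"
    using pA cA e(2) by blast
  ultimately show ?thesis by (auto simp: lepoll_def)
qed

lemma countable_times_lists_lepoll:
  assumes "infinite A" "countable F" shows "F \<times> lists A \<lesssim> A"
proof -
  have "F \<lesssim> (UNIV :: nat set)" using assms(2) by (auto simp: countable_def lepoll_def)
  also have "\<dots> \<lesssim> A" using assms(1) infinite_le_lepoll by blast
  finally have "F \<times> lists A \<lesssim> A \<times> A" using lists_lepoll[OF assms(1)] by (rule times_lepoll_mono)
  also have "\<dots> \<lesssim> A" by (rule infinite_times_lepoll[OF assms(1)])
  finally show ?thesis .
qed

instance tm :: (countable) countable by countable_datatype
instance fm :: (countable) countable by countable_datatype

section \<open>Countability and locality of formulas\<close>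

lemma set_tm_over: "tm_over \<sigma> t \<Longrightarrow> set_tm t \<subseteq> fun_syms \<sigma>"
  by (induction t) auto

lemma set_fm_over: "fm_over \<sigma> \<phi> \<Longrightarrow> set_fm \<phi> \<subseteq> fun_syms \<sigma> \<union> rel_syms \<sigma>"
  by (induction \<phi>) (use set_tm_over in fastforce)+

text \<open>Renaming symbols by natural numbers sends formulas into a countable datatype,
  injectively since only symbols of the signature occur.\<close>

lemma countable_formulas:
  assumes "countable_signature \<sigma>" shows "countable {\<phi>. fm_over \<sigma> \<phi>}"
proof -
  have "countable (fun_syms \<sigma> \<union> rel_syms \<sigma>)" using assms by (simp add: countable_signature_def)
  then obtain e :: "_ \<Rightarrow> nat" where e: "inj_on e (fun_syms \<sigma> \<union> rel_syms \<sigma>)"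
    unfolding countable_def by blast
  have "inj_on (map_fm e) {\<phi>. fm_over \<sigma> \<phi>}"
  proof (rule inj_onI)
    fix \<phi> \<psi> assume "\<phi> \<in> {\<phi>. fm_over \<sigma> \<phi>}" "\<psi> \<in> {\<phi>. fm_over \<sigma> \<phi>}" "map_fm e \<phi> = map_fm e \<psi>"
    then show "\<phi> = \<psi>"
      using set_fm_over inj_onD[OF e] by (intro fm.inj_map_strong[of \<phi> \<psi> e e]) blast+
  qed
  then show ?thesis by (rule countableI')
qed

lemma tm_val_local: "\<exists>n. \<forall>M s s'. (\<forall>i<n. s i = s' i) \<longrightarrow> tm_val M s t = tm_val M s' t"
proof (induction t)
  case (Var i)
  show ?case by (rule exI[of _ "Suc i"]) auto
next
  case (Fn f ts)
  then obtain n where n: "\<And>t M s s'. t \<in> set ts \<Longrightarrow> (\<forall>i<n t. s i = s' i) \<longrightarrow> tm_val M s t = tm_val M s' t"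
    by metis
  show ?case
  proof (rule exI[of _ "sum_list (map n ts)"], intro allI impI)
    fix M :: 'a and s s' :: "nat \<Rightarrow> 'a" assume *: "\<forall>i<sum_list (map n ts). s i = s' i"
    have "tm_val M s t = tm_val M s' t" if "t \<in> set ts" for t
      using n[OF that, of s s' M] * member_le_sum_list[of "n t" "map n ts"] that by auto
    then have "map (tm_val M s) ts = map (tm_val M s') ts" by simp
    then show "tm_val M s (Fn f ts) = tm_val M s' (Fn f ts)" by (simp only: tm_val.simps)
  qed
qed

text \<open>Only finitely many variables matter. The bound \<open>n\<close> does not depend on
  \<open>M\<close>, so one bound serves both structures when truth in them is compared.\<close>

lemma sat_local: "\<exists>n. \<forall>M s s'. (\<forall>i<n. s i = s' i) \<longrightarrow> sat M s \<phi> = sat M s' \<phi>"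
proof (induction \<phi>)
  case (Equal t u)
  obtain m n where mn: "\<And>M s s'. (\<forall>i<m. s i = s' i) \<Longrightarrow> tm_val M s t = tm_val M s' t"
    "\<And>M s s'. (\<forall>i<n. s i = s' i) \<Longrightarrow> tm_val M s u = tm_val M s' u"
    using tm_val_local[of t] tm_val_local[of u] by blast
  show ?case
  proof (rule exI[of _ "m + n"], intro allI impI)
    fix M :: 'a and s s' :: "nat \<Rightarrow> 'a" assume "\<forall>i<m + n. s i = s' i"
    then show "sat M s (Equal t u) = sat M s' (Equal t u)"
      using mn(1)[of s s' M] mn(2)[of s s' M] by simp
  qed
next
  case (Rel r ts)
  obtain k where k: "\<And>(t :: 'a tm) (M :: 'a) s s'. (\<forall>i<k t. s i = s' i) \<longrightarrow> tm_val M s t = tm_val M s' t"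
    using tm_val_local by metis
  show ?case
  proof (rule exI[of _ "sum_list (map k ts)"], intro allI impI)
    fix M :: 'a and s s' :: "nat \<Rightarrow> 'a" assume *: "\<forall>i<sum_list (map k ts). s i = s' i"
    have "tm_val M s t = tm_val M s' t" if "t \<in> set ts" for t
      using k[of t s s' M] * member_le_sum_list[of "k t" "map k ts"] that by auto
    then have "map (tm_val M s) ts = map (tm_val M s') ts" by simp
    then show "sat M s (Rel r ts) = sat M s' (Rel r ts)" by (simp only: sat.simps)
  qed
next
  case (Neg \<phi>)
  then show ?case by simp
next
  case (Conj \<phi> \<psi>)
  then obtain m n where mn: "\<And>M s s'. (\<forall>i<m. s i = s' i) \<Longrightarrow> sat M s \<phi> = sat M s' \<phi>"
    "\<And>M s s'. (\<forall>i<n. s i = s' i) \<Longrightarrow> sat M s \<psi> = sat M s' \<psi>"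
    by blast
  show ?case
  proof (rule exI[of _ "m + n"], intro allI impI)
    fix M :: 'a and s s' :: "nat \<Rightarrow> 'a" assume "\<forall>i<m + n. s i = s' i"
    then show "sat M s (Conj \<phi> \<psi>) = sat M s' (Conj \<phi> \<psi>)"
      using mn(1)[of s s' M] mn(2)[of s s' M] by simp
  qed
next
  case (Exists j \<phi>)
  then obtain n where n: "\<And>M s s'. (\<forall>i<n. s i = s' i) \<Longrightarrow> sat M s \<phi> = sat M s' \<phi>"
    by blast
  have "(\<forall>i<n. s i = s' i) \<longrightarrow> sat M s (Exists j \<phi>) = sat M s' (Exists j \<phi>)" for M s s'
  proof
    assume "\<forall>i<n. s i = s' i"
    then have "sat M (s(j := a)) \<phi> = sat M (s'(j := a)) \<phi>" for a by (intro n) auto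
    then show "sat M s (Exists j \<phi>) = sat M s' (Exists j \<phi>)" by simp
  qed
  then show ?case by blast
qed

section \<open>Subtle cardinals\<close>

text \<open>A usable form of subtlety: the club is a predicate \<open>P\<close>, and the list is a
  family of HOL sets bounded only at points of \<open>P\<close>.\<close>

lemma subtleE:
  assumes "subtle \<delta>"
    and unbounded: "\<And>\<alpha>. \<alpha> \<in> elts \<delta> \<Longrightarrow> \<exists>\<gamma>\<in>elts \<delta>. P \<gamma> \<and> \<alpha> \<in> elts \<gamma>"
    and closed: "\<And>\<alpha>. \<alpha> \<in> elts \<delta> \<Longrightarrow> elts \<alpha> \<noteq> {} \<Longrightarrow>
        \<forall>\<beta>\<in>elts \<alpha>. \<exists>\<gamma>\<in>elts \<alpha>. P \<gamma> \<and> \<beta> \<in> elts \<gamma> \<Longrightarrow> P \<alpha>"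
    and F: "\<And>\<gamma>. \<gamma> \<in> elts \<delta> \<Longrightarrow> P \<gamma> \<Longrightarrow> F \<gamma> \<subseteq> elts \<gamma>"
  obtains \<beta> \<gamma> where "\<gamma> \<in> elts \<delta>" "\<beta> \<in> elts \<gamma>" "P \<beta>" "P \<gamma>" "F \<beta> = F \<gamma> \<inter> elts \<beta>"
proof -
  define C where "C = set_of {\<gamma> \<in> elts \<delta>. P \<gamma>}"
  have C: "elts C = {\<gamma> \<in> elts \<delta>. P \<gamma>}"
    unfolding C_def by (rule elts_set_of) (rule small_subset[OF small_elts], blast)
  \<comment> \<open>Cutting off at \<open>\<gamma>\<close> gives a list everywhere and changes
    nothing on the club.\<close>
  define E where "E \<gamma> = set_of (F \<gamma> \<inter> elts \<gamma>)" for \<gamma>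
  have E: "elts (E \<gamma>) = F \<gamma> \<inter> elts \<gamma>" for \<gamma>
    unfolding E_def by (rule elts_set_of) (rule small_subset[OF small_elts], blast)
  have o: "Ord \<delta>" using assms(1) by (simp add: subtle_def CardD)
  have "closed_unbounded C \<delta>"
    unfolding closed_unbounded_def
  proof (intro conjI ballI impI)
    show "elts C \<subseteq> elts \<delta>" using C by blast
    show "\<exists>\<beta>\<in>elts C. \<alpha> \<in> elts \<beta>" if "\<alpha> \<in> elts \<delta>" for \<alpha> using unbounded[OF that] C by blast
    show "\<alpha> \<in> elts C"
      if "\<alpha> \<in> elts \<delta>" "elts \<alpha> \<noteq> {} \<and> (\<forall>\<beta>\<in>elts \<alpha>. \<exists>\<gamma>\<in>elts C \<inter> elts \<alpha>. \<beta> \<in> elts \<gamma>)" for \<alpha>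
      using closed[OF that(1)] that C by blast
  qed
  moreover have "ordinal_list \<delta> E" by (simp add: ordinal_list_def E)
  ultimately obtain \<beta> \<gamma> where *: "\<beta> \<in> elts C" "\<gamma> \<in> elts C" "\<beta> \<in> elts \<gamma>"
      "elts (E \<beta>) = elts (E \<gamma>) \<inter> elts \<beta>"
    using assms(1) unfolding subtle_def by blast
  then have "F \<beta> = F \<gamma> \<inter> elts \<beta>" using F[of \<beta>] F[of \<gamma>] C E by blast
  then show ?thesis using that * C by blast
qed

section \<open>Subtle cardinals are uncountable regular strong limits\<close>

lemma subtle_Card:
  assumes "subtle \<delta>"
  shows "Card \<delta>" "Ord \<delta>" "infinite (elts \<delta>)" "\<alpha> \<in> elts \<delta> \<Longrightarrow> succ \<alpha> \<in> elts \<delta>"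
  using assms infinite_Card_limit by (auto simp: subtle_def CardD)

lemma Ord_max:
  assumes "Ord (\<delta> :: 'a::zermelo)" "\<alpha> \<in> elts \<delta>" "\<beta> \<in> elts \<delta>"
  obtains \<gamma> where "\<gamma> \<in> elts \<delta>" "elts \<alpha> \<subseteq> elts \<gamma>" "elts \<beta> \<subseteq> elts \<gamma>" "\<gamma> = \<alpha> \<or> \<gamma> = \<beta>"
  using assms Ord_linear[of \<alpha> \<beta>] Ord_mem[OF assms(1)] Ord_transD[of \<alpha> \<beta>] Ord_transD[of \<beta> \<alpha>]
  by (metis order_refl)

text \<open>This is the common source of regularity and strong limitness. If \<open>f\<close> were
  unbounded, list at each \<open>\<gamma>\<close> a subset of \<open>\<nu>\<close> whose value is
  least above \<open>\<gamma>\<close>. Coherent points beyond \<open>\<nu>\<close> would share that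
  subset, although the club ensures that \<open>f\<close> takes a value above \<open>\<beta>\<close>
  and at most \<open>\<gamma>\<close>.\<close>

lemma subtle_bounded_Pow:
  assumes "subtle \<delta>" "\<nu> \<in> elts \<delta>" "\<And>Y. Y \<subseteq> elts \<nu> \<Longrightarrow> f Y \<in> elts \<delta>"
  shows "\<exists>\<gamma>\<in>elts \<delta>. \<forall>Y. Y \<subseteq> elts \<nu> \<longrightarrow> f Y \<in> elts \<gamma>"
proof (rule ccontr)
  assume neg: "\<not> ?thesis"
  note o\<delta> = subtle_Card(2)[OF assms(1)]
  have oF: "Ord (f Y)" if "Y \<subseteq> elts \<nu>" for Y using assms(3)[OF that] o\<delta> Ord_mem by blast
  have "\<exists>Y. Y \<subseteq> elts \<nu> \<and> \<gamma> \<in> elts (f Y) \<and>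
      (\<forall>Y'. Y' \<subseteq> elts \<nu> \<and> \<gamma> \<in> elts (f Y') \<longrightarrow> f Y = f Y' \<or> f Y \<in> elts (f Y'))"
    if \<gamma>: "\<gamma> \<in> elts \<delta>" for \<gamma>
  proof -
    have o: "Ord \<gamma>" using \<gamma> o\<delta> Ord_mem by blast
    obtain Y where Y: "Y \<subseteq> elts \<nu>" "f Y \<notin> elts (succ \<gamma>)"
      using neg subtle_Card(4)[OF assms(1) \<gamma>] by blast
    then have "\<gamma> \<in> elts (f Y)" using Ord_linear[OF o oF[OF Y(1)]] by auto
    then have "Y \<subseteq> elts \<nu> \<and> \<gamma> \<in> elts (f Y)" using Y by blast
    then have "\<exists>Y. (Y \<subseteq> elts \<nu> \<and> \<gamma> \<in> elts (f Y)) \<and>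
        (\<forall>Y'. Y' \<subseteq> elts \<nu> \<and> \<gamma> \<in> elts (f Y') \<longrightarrow> f Y = f Y' \<or> f Y \<in> elts (f Y'))"
      by (rule Ord_least_image) (use oF in blast)
    then show ?thesis by blast
  qed
  then obtain Y where Y: "\<And>\<gamma>. \<gamma> \<in> elts \<delta> \<Longrightarrow> Y \<gamma> \<subseteq> elts \<nu>"
    "\<And>\<gamma>. \<gamma> \<in> elts \<delta> \<Longrightarrow> \<gamma> \<in> elts (f (Y \<gamma>))"
    "\<And>\<gamma> Y'. \<gamma> \<in> elts \<delta> \<Longrightarrow> Y' \<subseteq> elts \<nu> \<Longrightarrow> \<gamma> \<in> elts (f Y') \<Longrightarrow> f (Y \<gamma>) = f Y' \<or> f (Y \<gamma>) \<in> elts (f Y')"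
    by metis
  \<comment> \<open>The points above \<open>\<nu>\<close> that are values of \<open>f\<close> or
    limits of values. The disjunct \<open>f Y = \<gamma>\<close> admits values themselves, which
    makes unboundedness immediate.\<close>
  define P where "P \<gamma> \<longleftrightarrow> \<nu> \<in> elts \<gamma> \<and>
    (\<forall>\<xi>\<in>elts \<gamma>. \<exists>Y. Y \<subseteq> elts \<nu> \<and> \<xi> \<in> elts (f Y) \<and> (f Y \<in> elts \<gamma> \<or> f Y = \<gamma>))" for \<gamma>
  have "\<exists>\<gamma>\<in>elts \<delta>. P \<gamma> \<and> \<alpha> \<in> elts \<gamma>" if \<alpha>: "\<alpha> \<in> elts \<delta>" for \<alpha>
  proof -
    have "\<exists>\<xi>. \<xi> \<in> elts \<delta> \<and> (\<alpha> = \<xi> \<or> \<alpha> \<in> elts \<xi>) \<and> (\<nu> = \<xi> \<or> \<nu> \<in> elts \<xi>)"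
      using Ord_linear[of \<alpha> \<nu>] \<alpha> assms(2) Ord_mem[OF o\<delta>] by blast
    then obtain \<xi> where \<xi>: "\<xi> \<in> elts \<delta>" "\<alpha> = \<xi> \<or> \<alpha> \<in> elts \<xi>" "\<nu> = \<xi> \<or> \<nu> \<in> elts \<xi>" by blast
    have o: "Ord (f (Y \<xi>))" using oF Y(1) \<xi> by blast
    have "\<alpha> \<in> elts (f (Y \<xi>))" "\<nu> \<in> elts (f (Y \<xi>))" using \<xi> Y(2)[OF \<xi>(1)] Ord_trans[OF o] by blast+
    moreover have "P (f (Y \<xi>))" unfolding P_def using calculation Y(1)[OF \<xi>(1)] by blast
    ultimately show ?thesis using assms(3)[OF Y(1)[OF \<xi>(1)]] by blast
  qed
  moreover have "P \<alpha>"
    if \<alpha>: "\<alpha> \<in> elts \<delta>" "elts \<alpha> \<noteq> {}" "\<forall>\<beta>\<in>elts \<alpha>. \<exists>\<gamma>\<in>elts \<alpha>. P \<gamma> \<and> \<beta> \<in> elts \<gamma>" for \<alpha>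
  proof -
    have o: "Ord \<alpha>" using \<alpha> o\<delta> Ord_mem by blast
    have "\<nu> \<in> elts \<alpha>" using \<alpha> Ord_trans[OF o] unfolding P_def by blast
    moreover have "\<exists>Y. Y \<subseteq> elts \<nu> \<and> \<xi> \<in> elts (f Y) \<and> (f Y \<in> elts \<alpha> \<or> f Y = \<alpha>)"
      if \<xi>: "\<xi> \<in> elts \<alpha>" for \<xi>
    proof -
      obtain \<gamma> where "\<gamma> \<in> elts \<alpha>" "P \<gamma>" "\<xi> \<in> elts \<gamma>" using \<alpha>(3) \<xi> by blast
      then show ?thesis using Ord_trans[OF o] unfolding P_def by blast
    qed
    ultimately show ?thesis by (simp add: P_def)
  qed
  moreover have "Y \<gamma> \<subseteq> elts \<gamma>" if "\<gamma> \<in> elts \<delta>" "P \<gamma>" for \<gamma>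
    using Y(1)[OF that(1)] that Ord_mem[OF o\<delta>] Ord_transD[of \<gamma> \<nu>] unfolding P_def by blast
  ultimately obtain \<beta> \<gamma> where bg: "\<gamma> \<in> elts \<delta>" "\<beta> \<in> elts \<gamma>" "P \<beta>" "P \<gamma>" "Y \<beta> = Y \<gamma> \<inter> elts \<beta>"
    by (rule subtleE[OF assms(1)])
  have o: "Ord \<beta>" "Ord \<gamma>" and \<beta>\<delta>: "\<beta> \<in> elts \<delta>" using bg o\<delta> Ord_mem Ord_trans by blast+
  \<comment> \<open>Since \<open>\<nu>\<close> lies below \<open>\<beta>\<close>, intersecting with
    \<open>\<beta>\<close> removes nothing.\<close>
  have "Y \<gamma> \<subseteq> elts \<beta>" using Y(1)[OF bg(1)] bg(3) Ord_transD[OF o(1)] unfolding P_def by blast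
  then have "Y \<beta> = Y \<gamma>" using bg(5) by blast
  then have in1: "\<gamma> \<in> elts (f (Y \<beta>))" using Y(2)[OF bg(1)] by simp
  obtain Y' where Y': "Y' \<subseteq> elts \<nu>" "\<beta> \<in> elts (f Y')" "f Y' \<in> elts \<gamma> \<or> f Y' = \<gamma>"
    using bg unfolding P_def by blast
  \<comment> \<open>Minimality at \<open>\<beta>\<close> gives a value at most \<open>f Y'\<close>,
    hence at most \<open>\<gamma>\<close>, whereas the shared subset has a value above
    \<open>\<gamma>\<close>.\<close>
  have "f (Y \<beta>) = f Y' \<or> f (Y \<beta>) \<in> elts (f Y')" by (rule Y(3)[OF \<beta>\<delta> Y'(1,2)])
  then have "\<gamma> \<in> elts (f Y')" using in1 Ord_trans[OF oF[OF Y'(1)]] by auto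
  then show False using Y'(3) mem_asym by auto
qed

lemma subtle_bounded:
  assumes "subtle \<delta>" "\<nu> \<in> elts \<delta>" "A \<lesssim> Pow (elts \<nu>)" "g ` A \<subseteq> elts \<delta>"
  shows "\<exists>\<gamma>\<in>elts \<delta>. g ` A \<subseteq> elts \<gamma>"
proof -
  obtain j where j: "inj_on j A" "j ` A \<subseteq> Pow (elts \<nu>)" using assms(3) by (auto simp: lepoll_def)
  \<comment> \<open>Subsets that code no element of \<open>A\<close> get the harmless value
    \<open>\<nu>\<close>, a member of \<open>\<delta>\<close>.\<close>
  define f where "f Y = (if Y \<in> j ` A then g (inv_into A j Y) else \<nu>)" for Y
  have "f Y \<in> elts \<delta>" for Y using assms(2,4) inv_into_into[of Y j A] by (auto simp: f_def)
  then obtain \<gamma> where \<gamma>: "\<gamma> \<in> elts \<delta>" "\<And>Y. Y \<subseteq> elts \<nu> \<Longrightarrow> f Y \<in> elts \<gamma>"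
    using subtle_bounded_Pow[OF assms(1,2), of f] by blast
  have "g a \<in> elts \<gamma>" if "a \<in> A" for a
  proof -
    have "f (j a) = g a" using that j(1) by (simp add: f_def)
    moreover have "j a \<subseteq> elts \<nu>" using that j by blast
    ultimately show ?thesis using \<gamma>(2) by metis
  qed
  then show ?thesis using \<gamma>(1) by blast
qed

text \<open>If \<open>\<delta>\<close> injected into the power set, its identity map would be
  bounded. By comparability the power set injects into \<open>\<delta>\<close>, and that injection
  is itself bounded.\<close>

lemma subtle_Pow_lepoll:
  assumes "subtle \<delta>" "\<nu> \<in> elts \<delta>"
  shows "\<exists>\<gamma>\<in>elts \<delta>. Pow (elts \<nu>) \<lesssim> elts \<gamma>"
proof -
  have "\<not> elts \<delta> \<lesssim> Pow (elts \<nu>)"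
  proof
    assume "elts \<delta> \<lesssim> Pow (elts \<nu>)"
    then obtain \<gamma> where "\<gamma> \<in> elts \<delta>" "elts \<delta> \<subseteq> elts \<gamma>"
      using subtle_bounded[OF assms, of "elts \<delta>" id] by auto
    then show False using mem_not_refl by blast
  qed
  then have "Pow (elts \<nu>) \<lesssim> elts \<delta>" using lepoll_total by blast
  then obtain g where g: "inj_on g (Pow (elts \<nu>))" "g ` Pow (elts \<nu>) \<subseteq> elts \<delta>"
    by (auto simp: lepoll_def)
  then obtain \<gamma> where "\<gamma> \<in> elts \<delta>" "g ` Pow (elts \<nu>) \<subseteq> elts \<gamma>"
    using subtle_bounded[OF assms lepoll_refl] by blast
  then show ?thesis using g by (auto simp: lepoll_def)
qed

text \<open>The witness is the least ordinal that does not inject into \<open>\<nu>\<close>;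
  Cantor's theorem and the bound on the power set place it below \<open>\<delta>\<close>.\<close>

lemma subtle_limit_cardinal:
  assumes "subtle (\<delta> :: 'a::zermelo)" "\<nu> \<in> elts \<delta>"
  shows "\<exists>\<kappa>\<in>elts \<delta>. Card \<kappa> \<and> \<nu> \<in> elts \<kappa>"
proof -
  note o\<delta> = subtle_Card(2)[OF assms(1)]
  obtain \<gamma> where \<gamma>: "\<gamma> \<in> elts \<delta>" "Pow (elts \<nu>) \<lesssim> elts \<gamma>" using subtle_Pow_lepoll[OF assms] by blast
  have "\<not> elts \<gamma> \<lesssim> elts \<nu>"
    using \<gamma>(2) lesspoll_Pow_self[of "elts \<nu>"] lepoll_trans lesspoll_trans2 lesspoll_not_refl by metis
  then have "Ord \<gamma> \<and> \<not> elts \<gamma> \<lesssim> elts \<nu>" using \<gamma> o\<delta> Ord_mem by blast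
  then obtain \<kappa> :: 'a where \<kappa>: "Ord \<kappa> \<and> \<not> elts \<kappa> \<lesssim> elts \<nu>"
    "\<And>y. Ord y \<and> \<not> elts y \<lesssim> elts \<nu> \<Longrightarrow> \<kappa> = y \<or> \<kappa> \<in> elts y"
    "\<And>y. y \<in> elts \<kappa> \<Longrightarrow> \<not> (Ord y \<and> \<not> elts y \<lesssim> elts \<nu>)"
    by (rule Ord_least[of "\<lambda>y. Ord y \<and> \<not> elts y \<lesssim> elts \<nu>" \<gamma>]) blast+
  have "Card \<kappa>"
    unfolding Card_def
  proof (intro conjI ballI)
    fix \<alpha> assume "\<alpha> \<in> elts \<kappa>"
    then have "elts \<alpha> \<lesssim> elts \<nu>" using \<kappa> Ord_mem by blast
    then show "\<not> elts \<alpha> \<approx> elts \<kappa>" using \<kappa>(1) eqpoll_sym lepoll_trans1 by blast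
  qed (use \<kappa> in blast)
  moreover have "\<kappa> \<in> elts \<delta>"
    using \<kappa>(2)[OF \<open>Ord \<gamma> \<and> \<not> elts \<gamma> \<lesssim> elts \<nu>\<close>] \<gamma>(1) Ord_trans[OF o\<delta>] by blast
  moreover have "\<nu> \<in> elts \<kappa>"
    using \<kappa>(1) Ord_not_mem[of \<nu> \<kappa>] Ord_mem[OF o\<delta> assms(2)] subset_imp_lepoll by blast
  ultimately show ?thesis by blast
qed

text \<open>This excludes \<omega>. If all members were finite, list at each nonzero
  \<open>\<gamma>\<close> the singleton of its predecessor; for \<open>\<beta>\<close> below
  \<open>\<gamma>\<close> that predecessor is at least \<open>\<beta>\<close>, so no pair
  coheres.\<close>

lemma subtle_infinite_mem:
  assumes "subtle (\<delta> :: 'a::zermelo)" shows "\<exists>w\<in>elts \<delta>. infinite (elts w)"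
proof (rule ccontr)
  assume fin: "\<not> ?thesis"
  note o\<delta> = subtle_Card(2)[OF assms]
  have "\<exists>\<mu>. elts \<gamma> = insert \<mu> (elts \<mu>)" if "\<gamma> \<in> elts \<delta>" "elts \<gamma> \<noteq> {}" for \<gamma>
    using finite_Ord_max[of \<gamma>] that fin Ord_mem[OF o\<delta>] by metis
  then obtain m where m: "\<And>\<gamma>. \<gamma> \<in> elts \<delta> \<Longrightarrow> elts \<gamma> \<noteq> {} \<Longrightarrow> elts \<gamma> = insert (m \<gamma>) (elts (m \<gamma>))"
    by metis
  have "\<exists>\<gamma>\<in>elts \<delta>. elts \<gamma> \<noteq> {} \<and> \<alpha> \<in> elts \<gamma>" if "\<alpha> \<in> elts \<delta>" for \<alpha>
    using subtle_Card(4)[OF assms that] by (intro bexI[of _ "succ \<alpha>"]) auto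
  moreover have "elts \<alpha> \<noteq> {}" if "\<alpha> \<in> elts \<delta>" "elts \<alpha> \<noteq> {}"
    "\<forall>\<beta>\<in>elts \<alpha>. \<exists>\<gamma>\<in>elts \<alpha>. elts \<gamma> \<noteq> {} \<and> \<beta> \<in> elts \<gamma>" for \<alpha>
    by (rule that(2))
  moreover have "{m \<gamma>} \<subseteq> elts \<gamma>" if "\<gamma> \<in> elts \<delta>" "elts \<gamma> \<noteq> {}" for \<gamma>
    using m[OF that] by blast
  ultimately obtain \<beta> \<gamma> where bg: "\<gamma> \<in> elts \<delta>" "\<beta> \<in> elts \<gamma>" "elts \<beta> \<noteq> {}" "elts \<gamma> \<noteq> {}" "{m \<beta>} = {m \<gamma>} \<inter> elts \<beta>"
    by (rule subtleE[OF assms, where P = "\<lambda>\<gamma>. elts \<gamma> \<noteq> {}" and F = "\<lambda>\<gamma>. {m \<gamma>}"])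
  have "m \<beta> \<in> {m \<gamma>} \<inter> elts \<beta>" using equalityD1[OF bg(5)] by blast
  then have "m \<gamma> \<in> elts \<beta>" by (elim IntE singletonE) (erule subst)
  moreover have "\<beta> \<in> insert (m \<gamma>) (elts (m \<gamma>))" using m[OF bg(1,4)] bg(2) by simp
  ultimately show False using mem_asym[of \<beta> "m \<gamma>"] by auto
qed

text \<open>A set in \<open>V \<alpha>\<close> is determined by a level \<open>r x\<close>
  containing its elements and by their image under an injection of that level. Regularity gives one
  target \<open>\<gamma>3\<close> for all levels, and the strong limit property bounds its power
  set.\<close>

lemma subtle_V_lepoll:
  assumes "subtle (\<delta> :: 'a::zermelo)" "\<alpha> \<in> elts \<delta>"
  shows "\<exists>\<gamma>\<in>elts \<delta>. V \<alpha> \<lesssim> elts \<gamma>"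
  using assms(2)
proof (induction \<alpha> rule: elts_induct)
  case (step \<alpha>)
  note o\<delta> = subtle_Card(2)[OF assms(1)]
  have "\<beta> \<in> elts \<delta>" if "\<beta> \<in> elts \<alpha>" for \<beta> using that step.prems Ord_trans[OF o\<delta>] by blast
  then obtain g where g: "\<And>\<beta>. \<beta> \<in> elts \<alpha> \<Longrightarrow> g \<beta> \<in> elts \<delta> \<and> V \<beta> \<lesssim> elts (g \<beta>)"
    using step.IH by metis
  then obtain \<gamma>1 where \<gamma>1: "\<gamma>1 \<in> elts \<delta>" "g ` elts \<alpha> \<subseteq> elts \<gamma>1"
    using subtle_bounded[OF assms(1) step.prems lepoll_Pow_self, of g] by blast
  obtain w where w: "w \<in> elts \<delta>" "infinite (elts w)" using subtle_infinite_mem[OF assms(1)] by blast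
  obtain \<gamma>2 where \<gamma>2: "\<gamma>2 \<in> elts \<delta>" "elts \<gamma>1 \<subseteq> elts \<gamma>2" "elts w \<subseteq> elts \<gamma>2"
    by (rule Ord_max[OF o\<delta> \<gamma>1(1) w(1)])
  obtain \<gamma>3 where \<gamma>3: "\<gamma>3 \<in> elts \<delta>" "elts \<gamma>2 \<subseteq> elts \<gamma>3" "elts \<alpha> \<subseteq> elts \<gamma>3"
    by (rule Ord_max[OF o\<delta> \<gamma>2(1) step.prems])
  have inf: "infinite (elts \<gamma>3)" using w(2) \<gamma>2 \<gamma>3 by (meson finite_subset)
  have "V \<beta> \<lesssim> elts \<gamma>3" if "\<beta> \<in> elts \<alpha>" for \<beta>
  proof -
    have "g \<beta> \<in> elts \<gamma>3" using that \<gamma>1 \<gamma>2 \<gamma>3 by blast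
    then have "elts (g \<beta>) \<lesssim> elts \<gamma>3"
      using Ord_transD[OF Ord_mem[OF o\<delta> \<gamma>3(1)]] subset_imp_lepoll by blast
    then show ?thesis using g[OF that] lepoll_trans by blast
  qed
  then obtain i where i: "\<And>\<beta>. \<beta> \<in> elts \<alpha> \<Longrightarrow> inj_on (i \<beta>) (V \<beta>) \<and> i \<beta> ` V \<beta> \<subseteq> elts \<gamma>3"
    unfolding lepoll_def by metis
  have "\<exists>\<beta>. \<beta> \<in> elts \<alpha> \<and> elts x \<subseteq> V \<beta>" if "x \<in> V \<alpha>" for x
    using that mem_V[of x \<alpha>] by blast
  then obtain r where r: "\<And>x. x \<in> V \<alpha> \<Longrightarrow> r x \<in> elts \<alpha> \<and> elts x \<subseteq> V (r x)" by metis
  have "inj_on (\<lambda>x. (r x, i (r x) ` elts x)) (V \<alpha>)"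
  proof (rule inj_onI)
    fix x y assume *: "x \<in> V \<alpha>" "y \<in> V \<alpha>" "(r x, i (r x) ` elts x) = (r y, i (r y) ` elts y)"
    then have "elts x = elts y"
      using inj_on_image_eq_iff[of "i (r x)" "V (r x)" "elts x" "elts y"] i[of "r x"] r[of x] r[of y]
      by auto
    then show "x = y" by (rule extensionality)
  qed
  moreover have "(\<lambda>x. (r x, i (r x) ` elts x)) ` V \<alpha> \<subseteq> elts \<gamma>3 \<times> Pow (elts \<gamma>3)"
    using r i \<gamma>3(3) by blast
  ultimately have "V \<alpha> \<lesssim> elts \<gamma>3 \<times> Pow (elts \<gamma>3)" unfolding lepoll_def by blast
  also have "\<dots> \<lesssim> Pow (elts \<gamma>3) \<times> Pow (elts \<gamma>3)"
    by (rule times_lepoll_mono[OF lepoll_Pow_self lepoll_refl])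
  also have "\<dots> \<lesssim> Pow (elts \<gamma>3)" by (rule infinite_times_lepoll) (use inf in simp)
  finally show ?case using subtle_Pow_lepoll[OF assms(1) \<gamma>3(1)] lepoll_trans by blast
qed

section \<open>Reflection through elementary diagrams\<close>

lemma Card_Union:
  assumes "elts (\<kappa> :: 'a::zermelo) = (\<Union>x\<in>X. elts x)" "\<And>x. x \<in> X \<Longrightarrow> Card x"
  shows "Card \<kappa>"
  unfolding Card_def
proof (intro conjI ballI notI)
  show "Ord \<kappa>" using assms(1) CardD[OF assms(2)] by (rule Ord_Union)
  fix \<alpha> assume \<alpha>: "\<alpha> \<in> elts \<kappa>" "elts \<alpha> \<approx> elts \<kappa>"
  then obtain x where x: "x \<in> X" "\<alpha> \<in> elts x" using assms(1) by auto
  have "elts x \<lesssim> elts \<kappa>" using x(1) assms(1) by (intro subset_imp_lepoll) auto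
  also have "elts \<kappa> \<approx> elts \<alpha>" using \<alpha>(2) by (rule eqpoll_sym)
  also have "elts \<alpha> \<prec> elts x" by (rule Card_lesspoll[OF assms(2)[OF x(1)] x(2)])
  finally show False by simp
qed

lemma finite_subset_bounded:
  assumes "Ord (\<kappa> :: 'a::zermelo)" "\<And>\<alpha>. \<alpha> \<in> elts \<kappa> \<Longrightarrow> succ \<alpha> \<in> elts \<kappa>" "elts \<kappa> \<noteq> {}"
    and "finite Y" "Y \<subseteq> elts \<kappa>"
  shows "\<exists>\<xi>\<in>elts \<kappa>. Y \<subseteq> elts \<xi>"
  using assms(4,5)
proof (induction Y)
  case empty then show ?case using assms(3) by auto
next
  case (insert y Y)
  then obtain \<xi> where \<xi>: "\<xi> \<in> elts \<kappa>" "Y \<subseteq> elts \<xi>" by auto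
  have "succ y \<in> elts \<kappa>" using insert.prems assms(2) by auto
  then obtain \<gamma> where "\<gamma> \<in> elts \<kappa>" "elts (succ y) \<subseteq> elts \<gamma>" "elts \<xi> \<subseteq> elts \<gamma>"
    using \<xi>(1) by (rule Ord_max[OF assms(1)])
  then show ?case using \<xi> by auto
qed

text \<open>A list of parameters determines a total assignment, with default \<open>d\<close> past
  its end. Parameters are indices that \<open>h\<close> translates into elements of a structure, so
  one list can be read in two structures.\<close>

definition assignment :: "('a::zermelo \<Rightarrow> 'a) \<Rightarrow> 'a \<Rightarrow> 'a list \<Rightarrow> nat \<Rightarrow> 'a" where
  "assignment h d xs i = h (if i < length xs then xs ! i else d)"

text \<open>A formula sees only finitely many variables, so agreement on finite parameter lists
  already gives elementarity for all assignments.\<close>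

lemma elementary_embedding_from_diagram:
  assumes g: "bij_betw g \<beta> (domain A)" and h: "h ` \<beta> \<subseteq> domain B"
    and diag: "\<And>\<phi> xs. fm_over \<sigma> \<phi> \<Longrightarrow> xs \<in> lists \<beta> \<Longrightarrow>
        sat A (assignment g d xs) \<phi> \<longleftrightarrow> sat B (assignment h d xs) \<phi>"
  shows "elementary_embedding \<sigma> (h \<circ> inv_into \<beta> g) A B"
  unfolding elementary_embedding_def
proof (intro conjI allI impI)
  have inv: "inv_into \<beta> g x \<in> \<beta>" "g (inv_into \<beta> g x) = x" if "x \<in> domain A" for x
    using that g inv_into_into[of x g \<beta>] f_inv_into_f[of x g \<beta>] by (auto simp: bij_betw_def)
  show "(h \<circ> inv_into \<beta> g) ` domain A \<subseteq> domain B" using inv(1) h by auto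
  fix \<phi> and s :: "nat \<Rightarrow> 'a" assume \<phi>: "fm_over \<sigma> \<phi> \<and> range s \<subseteq> domain A"
  obtain n where n: "\<And>(M :: 'a) s s'. (\<forall>i<n. s i = s' i) \<Longrightarrow> sat M s \<phi> = sat M s' \<phi>"
    using sat_local[of \<phi>] by blast
  define xs where "xs = map (inv_into \<beta> g \<circ> s) [0..<n]"
  have s: "s i \<in> domain A" for i using \<phi> by auto
  have "sat A s \<phi> = sat A (assignment g d xs) \<phi>"
    by (rule n) (use inv(2)[OF s] in \<open>simp add: assignment_def xs_def\<close>)
  also have "\<dots> = sat B (assignment h d xs) \<phi>"
    by (rule diag) (use \<phi> inv(1)[OF s] in \<open>auto simp: xs_def\<close>)
  also have "\<dots> = sat B ((h \<circ> inv_into \<beta> g) \<circ> s) \<phi>"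
    by (rule n) (simp add: assignment_def xs_def)
  finally show "sat A s \<phi> = sat B (h \<circ> inv_into \<beta> g \<circ> s) \<phi>" .
qed

lemma subtle_regular:
  assumes "subtle \<delta>" "\<nu> \<in> elts \<delta>" "A \<lesssim> elts \<nu>" "g ` A \<subseteq> elts \<delta>"
  shows "\<exists>\<gamma>\<in>elts \<delta>. g ` A \<subseteq> elts \<gamma>"
  using subtle_bounded[OF assms(1,2) lepoll_trans[OF assms(3) lepoll_Pow_self] assms(4)] .

lemma subtle_imp_WSR:
  fixes \<delta> :: "'a::zermelo"
  assumes \<delta>: "subtle \<delta>" and \<sigma>: "countable_signature \<sigma>"
    and A0: "A0 \<in> elts \<C>" "\<gamma>0 \<in> elts \<delta>" "domain A0 \<lesssim> elts \<gamma>0"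
  shows "\<exists>\<kappa>\<in>elts \<delta>. Card \<kappa> \<and> infinite (elts \<kappa>) \<and> WSR \<sigma> \<C> \<kappa>"
proof (rule ccontr)
  assume neg: "\<not> ?thesis"
  note o\<delta> = subtle_Card(2)[OF \<delta>]
  obtain w where w: "w \<in> elts \<delta>" "infinite (elts w)" using subtle_infinite_mem[OF \<delta>] by blast
  \<comment> \<open>Beyond \<open>\<gamma>1\<close>, cardinals are infinite and larger than the
    domain of \<open>A0\<close>, which secures the first clause of \<open>WSR\<close>.\<close>
  obtain \<gamma>1 where \<gamma>1: "\<gamma>1 \<in> elts \<delta>" "elts \<gamma>0 \<subseteq> elts \<gamma>1" "elts w \<subseteq> elts \<gamma>1"
    by (rule Ord_max[OF o\<delta> A0(2) w(1)])
  have inf1: "infinite (elts \<gamma>1)" using w(2) \<gamma>1(3) finite_subset by blast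
  define Fm where "Fm = {\<phi>. fm_over \<sigma> \<phi>}"
  have Fm: "countable Fm" unfolding Fm_def by (rule countable_formulas[OF \<sigma>])
  \<comment> \<open>One coding is fixed for all of \<open>\<delta>\<close>, so that diagrams of
    different structures can be compared as sets of ordinals.\<close>
  obtain c where c: "inj_on c (Fm \<times> lists (elts \<delta>))" "c ` (Fm \<times> lists (elts \<delta>)) \<subseteq> elts \<delta>"
    using countable_times_lists_lepoll[OF subtle_Card(3)[OF \<delta>] Fm] unfolding lepoll_def by blast
  \<comment> \<open>By regularity, the codes with parameters below \<open>\<xi>\<close> are bounded
    in \<open>\<delta>\<close>.\<close>
  have "\<exists>b\<in>elts \<delta>. c ` (Fm \<times> lists (elts \<xi>)) \<subseteq> elts b" if \<xi>: "\<xi> \<in> elts \<delta>" for \<xi>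
  proof -
    obtain \<nu> where \<nu>: "\<nu> \<in> elts \<delta>" "elts \<xi> \<subseteq> elts \<nu>" "elts w \<subseteq> elts \<nu>"
      by (rule Ord_max[OF o\<delta> \<xi> w(1)])
    have "infinite (elts \<nu>)" using w(2) \<nu>(3) finite_subset by blast
    then have "Fm \<times> lists (elts \<nu>) \<lesssim> elts \<nu>" using Fm by (rule countable_times_lists_lepoll)
    moreover have "Fm \<times> lists (elts \<xi>) \<lesssim> Fm \<times> lists (elts \<nu>)"
      using \<nu>(2) by (intro times_lepoll_mono lists_lepoll_mono subset_imp_lepoll) auto
    ultimately have "Fm \<times> lists (elts \<xi>) \<lesssim> elts \<nu>" using lepoll_trans by blast
    moreover have "c ` (Fm \<times> lists (elts \<xi>)) \<subseteq> elts \<delta>"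
      using c(2) lists_mono[OF Ord_transD[OF o\<delta> \<xi>]] by blast
    ultimately show ?thesis by (rule subtle_regular[OF \<delta> \<nu>(1)])
  qed
  then obtain b where b: "\<And>\<xi>. \<xi> \<in> elts \<delta> \<Longrightarrow> b \<xi> \<in> elts \<delta>"
    "\<And>\<xi>. \<xi> \<in> elts \<delta> \<Longrightarrow> c ` (Fm \<times> lists (elts \<xi>)) \<subseteq> elts (b \<xi>)" by metis
  \<comment> \<open>The club consists of the cardinals above \<open>\<gamma>1\<close> that are
    closed under the coding.\<close>
  define P where "P \<kappa> \<longleftrightarrow> Card \<kappa> \<and> \<gamma>1 \<in> elts \<kappa> \<and>
      (\<forall>\<xi>\<in>elts \<kappa>. c ` (Fm \<times> lists (elts \<xi>)) \<subseteq> elts \<kappa>)" for \<kappa>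
  have above: "\<exists>\<kappa>. \<kappa> \<in> elts \<delta> \<and> Card \<kappa> \<and> \<alpha> \<in> elts \<kappa> \<and> \<beta> \<in> elts \<kappa>"
    if ab: "\<alpha> \<in> elts \<delta>" "\<beta> \<in> elts \<delta>" for \<alpha> \<beta>
  proof -
    obtain \<nu> where \<nu>: "\<nu> \<in> elts \<delta>" "elts (succ \<alpha>) \<subseteq> elts \<nu>" "elts (succ \<beta>) \<subseteq> elts \<nu>"
      by (rule Ord_max[OF o\<delta> subtle_Card(4)[OF \<delta> ab(1)] subtle_Card(4)[OF \<delta> ab(2)]])
    obtain \<kappa> where \<kappa>: "\<kappa> \<in> elts \<delta>" "Card \<kappa>" "\<nu> \<in> elts \<kappa>"
      using subtle_limit_cardinal[OF \<delta> \<nu>(1)] by blast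
    have "elts \<nu> \<subseteq> elts \<kappa>" by (rule Ord_transD[OF CardD[OF \<kappa>(2)] \<kappa>(3)])
    then have "\<alpha> \<in> elts \<kappa>" "\<beta> \<in> elts \<kappa>" using \<nu>(2,3) by auto
    then show ?thesis using \<kappa> by blast
  qed
  have unbounded: "\<exists>\<kappa>\<in>elts \<delta>. P \<kappa> \<and> \<alpha> \<in> elts \<kappa>" if \<alpha>: "\<alpha> \<in> elts \<delta>" for \<alpha>
  proof -
    obtain k0 where k0: "k0 \<in> elts \<delta>" "Card k0" "\<alpha> \<in> elts k0" "\<gamma>1 \<in> elts k0"
      using above[OF \<alpha> \<gamma>1(1)] by blast
    have "\<forall>\<xi>. \<xi> \<in> elts \<delta> \<longrightarrow> (\<exists>\<kappa>. \<kappa> \<in> elts \<delta> \<and> Card \<kappa> \<and> \<xi> \<in> elts \<kappa> \<and> b \<xi> \<in> elts \<kappa>)"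
      using above b(1) by blast
    then obtain nx where nx: "\<And>\<xi>. \<xi> \<in> elts \<delta> \<Longrightarrow>
        nx \<xi> \<in> elts \<delta> \<and> Card (nx \<xi>) \<and> \<xi> \<in> elts (nx \<xi>) \<and> b \<xi> \<in> elts (nx \<xi>)" by metis
    \<comment> \<open>Each cardinal in this sequence bounds the codes with parameters from its
      predecessor; the supremum is closed under coding and, by regularity, lies below
      \<open>\<delta>\<close>.\<close>
    define r where "r n = (nx ^^ n) k0" for n
    have r: "r 0 = k0" "r (Suc n) = nx (r n)" for n by (simp_all add: r_def)
    have r\<delta>: "r n \<in> elts \<delta>" for n by (induction n) (use r k0(1) nx in auto)
    have rC: "Card (r n)" for n by (cases n) (use r k0(2) nx[OF r\<delta>] in auto)
    have "(UNIV :: nat set) \<lesssim> elts w" using w(2) infinite_le_lepoll by blast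
    then obtain \<gamma> where \<gamma>: "\<gamma> \<in> elts \<delta>" "range r \<subseteq> elts \<gamma>"
      using subtle_regular[OF \<delta> w(1), of UNIV r] r\<delta> by blast
    have o\<gamma>: "Ord \<gamma>" by (rule Ord_mem[OF o\<delta> \<gamma>(1)])
    define \<kappa> where "\<kappa> = set_of (\<Union>n. elts (r n))"
    have sub: "(\<Union>n. elts (r n)) \<subseteq> elts \<gamma>" using \<gamma>(2) Ord_transD[OF o\<gamma>] by blast
    then have \<kappa>: "elts \<kappa> = (\<Union>n. elts (r n))"
      unfolding \<kappa>_def by (intro elts_set_of small_subset[OF small_elts])
    have C\<kappa>: "Card \<kappa>" by (rule Card_Union[of \<kappa> "range r"]) (use \<kappa> rC in auto)
    have "\<kappa> = \<gamma> \<or> \<kappa> \<in> elts \<gamma>" using Ord_subset_iff[OF CardD[OF C\<kappa>] o\<gamma>] sub \<kappa> by simp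
    then have \<kappa>\<delta>: "\<kappa> \<in> elts \<delta>" using \<gamma>(1) Ord_trans[OF o\<delta>] by blast
    have "elts k0 \<subseteq> elts \<kappa>" unfolding \<kappa> using r(1) by blast
    then have in\<kappa>: "\<alpha> \<in> elts \<kappa>" "\<gamma>1 \<in> elts \<kappa>" using k0 by blast+
    have "c ` (Fm \<times> lists (elts \<xi>)) \<subseteq> elts \<kappa>" if "\<xi> \<in> elts \<kappa>" for \<xi>
    proof -
      obtain n where n: "\<xi> \<in> elts (r n)" using \<open>\<xi> \<in> elts \<kappa>\<close> \<kappa> by auto
      have "elts \<xi> \<subseteq> elts (r n)" by (rule Ord_transD[OF CardD[OF rC] n])
      then have "c ` (Fm \<times> lists (elts \<xi>)) \<subseteq> c ` (Fm \<times> lists (elts (r n)))"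
        by (intro image_mono Sigma_mono lists_mono) auto
      also have "\<dots> \<subseteq> elts (b (r n))" by (rule b(2)[OF r\<delta>])
      also have "b (r n) \<in> elts (r (Suc n))" using nx[OF r\<delta>] r(2) by simp
      then have "elts (b (r n)) \<subseteq> elts (r (Suc n))" by (rule Ord_transD[OF CardD[OF rC]])
      also have "\<dots> \<subseteq> elts \<kappa>" unfolding \<kappa> by blast
      finally show ?thesis .
    qed
    then have "P \<kappa>" using C\<kappa> in\<kappa>(2) by (simp add: P_def)
    then show ?thesis using \<kappa>\<delta> in\<kappa>(1) by blast
  qed
  have closed: "P \<alpha>"
    if \<alpha>: "\<alpha> \<in> elts \<delta>" "elts \<alpha> \<noteq> {}" "\<forall>\<beta>\<in>elts \<alpha>. \<exists>\<gamma>\<in>elts \<alpha>. P \<gamma> \<and> \<beta> \<in> elts \<gamma>" for \<alpha>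
  proof -
    have o: "Ord \<alpha>" by (rule Ord_mem[OF o\<delta> \<alpha>(1)])
    have sub: "elts \<gamma> \<subseteq> elts \<alpha>" if "\<gamma> \<in> elts \<alpha>" for \<gamma> by (rule Ord_transD[OF o that])
    have "elts \<alpha> = (\<Union>\<gamma>\<in>{\<gamma>\<in>elts \<alpha>. P \<gamma>}. elts \<gamma>)" using \<alpha>(3) sub by blast
    then have "Card \<alpha>" by (rule Card_Union) (simp add: P_def)
    moreover have "\<gamma>1 \<in> elts \<alpha>"
    proof -
      obtain \<gamma> where "\<gamma> \<in> elts \<alpha>" "P \<gamma>" using \<alpha>(2,3) by blast
      then show ?thesis using sub unfolding P_def by blast
    qed
    moreover have "c ` (Fm \<times> lists (elts \<xi>)) \<subseteq> elts \<alpha>" if "\<xi> \<in> elts \<alpha>" for \<xi>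
    proof -
      obtain \<gamma> where \<gamma>: "\<gamma> \<in> elts \<alpha>" "P \<gamma>" "\<xi> \<in> elts \<gamma>" using \<alpha>(3) \<open>\<xi> \<in> elts \<alpha>\<close> by blast
      then have "c ` (Fm \<times> lists (elts \<xi>)) \<subseteq> elts \<gamma>" by (simp add: P_def)
      then show ?thesis using sub[OF \<gamma>(1)] by blast
    qed
    ultimately show ?thesis by (simp add: P_def)
  qed
  have inf: "infinite (elts \<kappa>)" if "P \<kappa>" for \<kappa>
    using that inf1 Ord_transD[of \<kappa> \<gamma>1] CardD finite_subset unfolding P_def by blast
  define bad where "bad \<kappa> B \<longleftrightarrow> B \<in> elts \<C> \<and> domain B \<approx> elts \<kappa> \<and>
      (\<forall>A h. A \<in> elts \<C> \<longrightarrow> domain A \<prec> elts \<kappa> \<longrightarrow> \<not> elementary_embedding \<sigma> h A B)" for \<kappa> B :: 'a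
  have "\<exists>B. bad \<kappa> B"
    if \<kappa>: "\<kappa> \<in> elts \<delta>" "P \<kappa>" for \<kappa>
  proof -
    have "domain A0 \<lesssim> elts \<gamma>1" using A0(3) \<gamma>1(2) subset_imp_lepoll lepoll_trans by blast
    also have "elts \<gamma>1 \<prec> elts \<kappa>" using \<kappa>(2) Card_lesspoll unfolding P_def by blast
    finally have "domain A0 \<prec> elts \<kappa>" .
    moreover have "\<not> WSR \<sigma> \<C> \<kappa>" using neg \<kappa> inf[OF \<kappa>(2)] unfolding P_def by blast
    ultimately show ?thesis using A0(1) unfolding WSR_def bad_def by blast
  qed
  then obtain B where "\<And>\<kappa>. \<kappa> \<in> elts \<delta> \<Longrightarrow> P \<kappa> \<Longrightarrow> bad \<kappa> (B \<kappa>)" by metis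
  then have B: "\<And>\<kappa>. \<kappa> \<in> elts \<delta> \<Longrightarrow> P \<kappa> \<Longrightarrow> B \<kappa> \<in> elts \<C>"
    "\<And>\<kappa>. \<kappa> \<in> elts \<delta> \<Longrightarrow> P \<kappa> \<Longrightarrow> domain (B \<kappa>) \<approx> elts \<kappa>"
    "\<And>\<kappa> A h. \<kappa> \<in> elts \<delta> \<Longrightarrow> P \<kappa> \<Longrightarrow> A \<in> elts \<C> \<Longrightarrow> domain A \<prec> elts \<kappa> \<Longrightarrow>
        \<not> elementary_embedding \<sigma> h A (B \<kappa>)"
    unfolding bad_def by blast+
  have "\<exists>h. bij_betw h (elts \<kappa>) (domain (B \<kappa>))" if "\<kappa> \<in> elts \<delta>" "P \<kappa>" for \<kappa>
    using eqpoll_sym[OF B(2)[OF that]] unfolding eqpoll_def .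
  then obtain h where h: "\<And>\<kappa>. \<kappa> \<in> elts \<delta> \<Longrightarrow> P \<kappa> \<Longrightarrow> bij_betw (h \<kappa>) (elts \<kappa>) (domain (B \<kappa>))"
    by metis
  \<comment> \<open>The elementary diagram of \<open>B \<kappa>\<close>, with its elements renamed
    as ordinals through \<open>h \<kappa>\<close>. The default \<open>\<gamma>1\<close> is below
    every \<open>\<kappa>\<close> in the club.\<close>
  define F where "F \<kappa> = {c (\<phi>, xs) |\<phi> xs. \<phi> \<in> Fm \<and> xs \<in> lists (elts \<kappa>) \<and>
      sat (B \<kappa>) (assignment (h \<kappa>) \<gamma>1 xs) \<phi>}" for \<kappa>
  have code: "c (\<phi>, xs) \<in> elts \<kappa>"
    if \<kappa>: "P \<kappa>" and xs: "\<phi> \<in> Fm" "xs \<in> lists (elts \<kappa>)" for \<kappa> \<phi> xs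
  proof -
    have C\<kappa>: "Card \<kappa>" using \<kappa> by (simp add: P_def)
    have "elts \<kappa> \<noteq> {}" using inf[OF \<kappa>] by auto
    \<comment> \<open>An infinite cardinal is a limit, so the finitely many entries of
      \<open>xs\<close> are bounded below \<open>\<kappa>\<close>; closure under coding then
      applies.\<close>
    then have "\<exists>\<xi>\<in>elts \<kappa>. set xs \<subseteq> elts \<xi>"
      using xs(2) by (intro finite_subset_bounded[OF CardD[OF C\<kappa>]
          infinite_Card_limit[OF C\<kappa> inf[OF \<kappa>]]]) auto
    then obtain \<xi> where \<xi>: "\<xi> \<in> elts \<kappa>" "set xs \<subseteq> elts \<xi>" by blast
    have "(\<phi>, xs) \<in> Fm \<times> lists (elts \<xi>)" using xs(1) \<xi>(2) by auto
    moreover have "c ` (Fm \<times> lists (elts \<xi>)) \<subseteq> elts \<kappa>" using \<kappa> \<xi>(1) by (simp add: P_def)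
    ultimately show ?thesis by blast
  qed
  have F: "F \<kappa> \<subseteq> elts \<kappa>" if "\<kappa> \<in> elts \<delta>" "P \<kappa>" for \<kappa>
    using code[OF that(2)] unfolding F_def by blast
  obtain \<beta> \<gamma> where bg: "\<gamma> \<in> elts \<delta>" "\<beta> \<in> elts \<gamma>" "P \<beta>" "P \<gamma>" "F \<beta> = F \<gamma> \<inter> elts \<beta>"
    by (rule subtleE[OF \<delta> unbounded closed F])
  have \<beta>\<delta>: "\<beta> \<in> elts \<delta>" using bg Ord_trans[OF o\<delta>] by blast
  have \<beta>\<gamma>: "elts \<beta> \<subseteq> elts \<gamma>" by (rule Ord_transD[OF Ord_mem[OF o\<delta> bg(1)] bg(2)])
  have F_iff: "c (\<phi>, xs) \<in> F \<kappa> \<longleftrightarrow> sat (B \<kappa>) (assignment (h \<kappa>) \<gamma>1 xs) \<phi>"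
    if "\<kappa> \<in> elts \<delta>" "\<phi> \<in> Fm" "xs \<in> lists (elts \<kappa>)" for \<kappa> \<phi> xs
  proof
    assume "c (\<phi>, xs) \<in> F \<kappa>"
    then obtain \<psi> ys where *: "c (\<phi>, xs) = c (\<psi>, ys)" "\<psi> \<in> Fm" "ys \<in> lists (elts \<kappa>)"
      "sat (B \<kappa>) (assignment (h \<kappa>) \<gamma>1 ys) \<psi>" unfolding F_def by blast
    have "lists (elts \<kappa>) \<subseteq> lists (elts \<delta>)" by (rule lists_mono[OF Ord_transD[OF o\<delta> that(1)]])
    then have "(\<phi>, xs) = (\<psi>, ys)" using that * by (intro inj_onD[OF c(1)]) auto
    then show "sat (B \<kappa>) (assignment (h \<kappa>) \<gamma>1 xs) \<phi>" using * by simp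
  qed (use that in \<open>auto simp: F_def\<close>)
  \<comment> \<open>Each index below \<open>\<beta>\<close> names an element in both structures.
    Formulas with such parameters have codes below \<open>\<beta>\<close>, so intersecting with
    \<open>\<beta>\<close> loses none of them.\<close>
  have "elementary_embedding \<sigma> (h \<gamma> \<circ> inv_into (elts \<beta>) (h \<beta>)) (B \<beta>) (B \<gamma>)"
  proof (rule elementary_embedding_from_diagram[OF h[OF \<beta>\<delta> bg(3)], where d = \<gamma>1])
    show "h \<gamma> ` elts \<beta> \<subseteq> domain (B \<gamma>)"
      using h[OF bg(1,4)] \<beta>\<gamma> unfolding bij_betw_def by blast
    fix \<phi> xs assume \<phi>: "fm_over \<sigma> \<phi>" and xs: "xs \<in> lists (elts \<beta>)"
    have Fm\<phi>: "\<phi> \<in> Fm" using \<phi> by (simp add: Fm_def)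
    have xs': "xs \<in> lists (elts \<gamma>)" using xs lists_mono[OF \<beta>\<gamma>] by blast
    have "sat (B \<beta>) (assignment (h \<beta>) \<gamma>1 xs) \<phi> \<longleftrightarrow> c (\<phi>, xs) \<in> F \<gamma> \<inter> elts \<beta>"
      using F_iff[OF \<beta>\<delta> Fm\<phi> xs] bg(5) by simp
    also have "\<dots> \<longleftrightarrow> sat (B \<gamma>) (assignment (h \<gamma>) \<gamma>1 xs) \<phi>"
      using F_iff[OF bg(1) Fm\<phi> xs'] code[OF bg(3) Fm\<phi> xs] by simp
    finally show "sat (B \<beta>) (assignment (h \<beta>) \<gamma>1 xs) \<phi> \<longleftrightarrow>
        sat (B \<gamma>) (assignment (h \<gamma>) \<gamma>1 xs) \<phi>" .
  qed
  moreover have "domain (B \<beta>) \<prec> elts \<gamma>"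
    using B(2)[OF \<beta>\<delta> bg(3)] Card_lesspoll[of \<gamma> \<beta>] bg(2,4) eq_lesspoll_trans
    unfolding P_def by blast
  ultimately show False using B(3)[OF bg(1,4) B(1)[OF \<beta>\<delta> bg(3)]] by blast
qed

section \<open>The equivalence\<close>

lemma subtle_domain_lepoll:
  assumes "subtle (\<delta> :: 'a::zermelo)" "opair D I \<in> V \<delta>"
  shows "\<exists>\<gamma>\<in>elts \<delta>. elts D \<lesssim> elts \<gamma>"
proof -
  note o\<delta> = subtle_Card(2)[OF assms(1)]
  have "D \<in> V \<delta>" by (rule fst_in_V[OF o\<delta> assms(2)])
  then obtain \<beta> where \<beta>: "\<beta> \<in> elts \<delta>" "elts D \<subseteq> V \<beta>" using mem_V by blast
  then obtain \<gamma> where "\<gamma> \<in> elts \<delta>" "V \<beta> \<lesssim> elts \<gamma>" using subtle_V_lepoll[OF assms(1)] by blast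
  then show ?thesis using subset_imp_lepoll[OF \<beta>(2)] lepoll_trans by blast
qed

theorem theorem1p18:
  fixes \<delta> :: "'a::cumulative"
  assumes "Card \<delta>" and "uncountable (elts \<delta>)"
  shows "(subtle \<delta> \<or> limit_of_subtle \<delta>) \<longleftrightarrow>
    (\<forall>\<sigma> \<C>. countable_signature \<sigma> \<and> (\<forall>M\<in>elts \<C>. is_structure \<sigma> M) \<and>
        \<C> \<in> V (succ \<delta>) - V \<delta> \<longrightarrow>
      (\<exists>\<kappa>\<in>elts \<delta>. Card \<kappa> \<and> infinite (elts \<kappa>) \<and> WSR \<sigma> \<C> \<kappa>))"
proof (intro iffI allI impI)
  note o\<delta> = CardD[OF assms(1)]
  fix \<sigma> and \<C> :: 'a
  assume sub: "subtle \<delta> \<or> limit_of_subtle \<delta>"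
    and "countable_signature \<sigma> \<and> (\<forall>M\<in>elts \<C>. is_structure \<sigma> M) \<and> \<C> \<in> V (succ \<delta>) - V \<delta>"
  then have \<sigma>: "countable_signature \<sigma>" and str: "\<And>M. M \<in> elts \<C> \<Longrightarrow> is_structure \<sigma> M"
    and \<C>: "elts \<C> \<subseteq> V \<delta>" "\<C> \<notin> V \<delta>" by (auto simp: V_succ[OF o\<delta>])
  have "\<delta> \<noteq> set_of {}" using assms(2) by auto
  then have "elts \<delta> \<noteq> {}" by (metis set_of_elts)
  \<comment> \<open>The empty set is in \<open>V \<delta>\<close>, so a class outside
    \<open>V \<delta>\<close> has a member.\<close>
  then have "elts \<C> \<noteq> {}" using \<C>(2) mem_V[of \<C> \<delta>] by auto
  then obtain M where M: "M \<in> elts \<C>" by blast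
  then obtain D I where DI: "M = opair D I" using str unfolding is_structure_def by blast
  have "M \<in> V \<delta>" using M \<C>(1) by blast
  \<comment> \<open>In the limit case a subtle cardinal above a rank bound for \<open>M\<close> is
    enough: the \<open>\<kappa>\<close> found below it is also below
    \<open>\<delta>\<close>.\<close>
  have "\<exists>\<delta>'. subtle \<delta>' \<and> elts \<delta>' \<subseteq> elts \<delta> \<and> M \<in> V \<delta>'"
    using sub
  proof
    assume "subtle \<delta>" then show ?thesis using \<open>M \<in> V \<delta>\<close> by blast
  next
    assume lim: "limit_of_subtle \<delta>"
    obtain \<beta> where \<beta>: "\<beta> \<in> elts \<delta>" "elts M \<subseteq> V \<beta>" using \<open>M \<in> V \<delta>\<close> mem_V[of M \<delta>] by blast
    then obtain \<delta>' where d: "\<delta>' \<in> elts \<delta>" "\<beta> \<in> elts \<delta>'" "subtle \<delta>'"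
      using lim unfolding limit_of_subtle_def by blast
    then have "M \<in> V \<delta>'" using \<beta>(2) mem_V[of M \<delta>'] by blast
    then show ?thesis using d Ord_transD[OF o\<delta> d(1)] by blast
  qed
  then obtain \<delta>' where d: "subtle \<delta>'" "elts \<delta>' \<subseteq> elts \<delta>" "M \<in> V \<delta>'" by blast
  obtain \<gamma> where "\<gamma> \<in> elts \<delta>'" "domain M \<lesssim> elts \<gamma>"
    using subtle_domain_lepoll[OF d(1), of D I] d(3) by (auto simp: DI)
  then show "\<exists>\<kappa>\<in>elts \<delta>. Card \<kappa> \<and> infinite (elts \<kappa>) \<and> WSR \<sigma> \<C> \<kappa>"
    using subtle_imp_WSR[OF d(1) \<sigma> M] d(2) by blast
next
  assume "\<forall>\<sigma> \<C>. countable_signature \<sigma> \<and> (\<forall>M\<in>elts \<C>. is_structure \<sigma> M) \<and>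
        \<C> \<in> V (succ \<delta>) - V \<delta> \<longrightarrow>
      (\<exists>\<kappa>\<in>elts \<delta>. Card \<kappa> \<and> infinite (elts \<kappa>) \<and> WSR \<sigma> \<C> \<kappa>)"
  \<comment> \<open>The class obtained from \<open>not_subtle_imp_not_WSR\<close> fails at every
    cardinal below \<open>\<delta>\<close>, finite ones included.\<close>
  then show "subtle \<delta> \<or> limit_of_subtle \<delta>" using not_subtle_imp_not_WSR[OF assms] by blast
qed

end
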